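(* Let $(E,\mathcal E)$ be a measurable space and let $\bar{\mathbb P}=(\bar{\mathbb P}_x(1,dy))_{x\in E}$ be a fixed homogeneous (linear) Markov transition kernel on $(E,\mathcal E)$, with associated operator $\bar V$ (defined in the context) having spectral radius $r(\bar V)$. Then for every $\delta>0$ small enough there exist $\lambda(\delta)>0$, $\gamma(\delta)>0$ and a constant $C>0$ such that the following holds for every $0<\gamma<\gamma(\delta)$ and every $0\le\lambda_1<\lambda(\delta)$. Let $(\mathbb P_\mu(x,dy))_{x\in E,\ \mu\in\mathcal P(E)}$ be a family of transition kernels (defining a nonlinear Markov chain) such that: (i) for all $x\in E$ and $\mu\in\mathcal P(E)$ the measures $\bar{\mathbb P}_x(1,\cdot)$ and $\mathbb P_\mu(x,\cdot)$ are mutually absolutely continuous and $$\frac{\bar{\mathbb P}_x(1,dy)}{\mathbb P_\mu(x,dy)}\le 1+\gamma\qquad\text{for all } x,y\in E,\ \mu\in\mathcal P(E);$$ (ii) for every $k\ge1$ there is a constant $\lambda_k<\infty$ (for $k=1$, the given $\lambda_1$) such that $$\|\mathbb P^{(k)}_\mu(x,\cdot)-\mathbb P^{(k)}_\nu(x,\cdot)\|_{TV}\le\lambda_k\|\mu-\nu\|_{TV}\qquad\text{for all } x\in E,\ \mu,\nu\in\mathcal P(E).$$ Then for all $n$ large enough, and for all initial distributions $\mu_0,\nu_0\in\mathcal P(E)$, $$\|\mu_n-\nu_n\|_{TV}\le 2C\,(r(\bar V)+\delta)^n .$$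
   Context: $\mathcal P(E)$ is the set of probability measures on $(E,\mathcal E)$. The total variation distance is normalised as $\|\mu-\nu\|_{TV}=2\sup_{A}(\mu(A)-\nu(A))$. Nonlinear Markov chain: for a family of transition kernels $\mathbb P_\mu(x,dy)$ depending on $\mu\in\mathcal P(E)$, the chain with initial law $\mu_0$ satisfies $\mathbb P(X_{n+1}\in B\mid X_n=x;\ \mathrm{Law}(X_n)=\mu_n)=\mathbb P_{\mu_n}(x,B)$. Its marginal laws are given recursively by $\mu_{n+1}=\mu_n\mathbb P_{\mu_n}$, i.e. $\mu_{n+1}(B)=\int\mu_n(dx)\,\mathbb P_{\mu_n}(x,B)$. The sequence $\nu_n$ is defined in the same way from $\nu_0$, with the same family of kernels. $k$-step kernels: for $\mu\in\mathcal P(E)$ put $\mu_0=\mu$, $\mu_k=\mu_{k-1}\mathbb P_{\mu_{k-1}}$, $\mathbb P^{(0)}_\mu(x,\cdot)=\delta_x$, and $\mathbb P^{(k)}_\mu(x,\cdot)=\delta_x\mathbb P^{(k-1)}_\mu\mathbb P_{\mu_{k-1}}$ for $k\ge1$; that is, $\mathbb P_\mu^{(k)}(x,\cdot)=\delta_x\mathbb P_{\mu_0}\mathbb P_{\mu_1}\cdots\mathbb P_{\mu_{k-1}}$. The operator $\bar V$: for $x^1,x^2\in E$ let $\bar p(x^i,\cdot)$, $i=1,2$, be the densities of $\bar{\mathbb P}_{x^i}(1,\cdot)$ with respect to a common dominating measure $\Lambda$ (the objects below do not depend on its choice). Put $$\bar\kappa(x^1,x^2)=\int \bar p(x^1,u)\wedge\bar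 p(x^2,u)\,\Lambda(du)=\int\Big(\frac{\bar{\mathbb P}_{x^1}(1,dy)}{\bar{\mathbb P}_{x^2}(1,dy)}\wedge1\Big)\bar{\mathbb P}_{x^2}(1,dy)$$ and, when $\bar\kappa(x^1,x^2)<1$, $$\bar\phi_i(x^1,x^2;u)=\frac{\bar p(x^i,u)-\bar p(x^1,u)\wedge\bar p(x^2,u)}{1-\bar\kappa(x^1,x^2)},\qquad i=1,2 .$$ For bounded measurable $h:E\times E\to\mathbb R$, $$\bar Vh(x^1,x^2)=(1-\bar\kappa(x^1,x^2))\iint h(u^1,u^2)\,\bar\phi_1(x^1,x^2;u^1)\,\bar\phi_2(x^1,x^2;u^2)\,\Lambda(du^1)\Lambda(du^2),$$ and $\bar Vh(x^1,x^2)=0$ when $\bar\kappa(x^1,x^2)=1$. The operator $\bar V$ is a non-negative bounded linear operator on the space of bounded measurable functions on $E\times E$ with the sup-norm (measurability of these expressions in $(x^1,x^2)$ is tacitly assumed), and $r(\bar V)$ denotes its spectral radius. *)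

theory Defs
  imports "HOL-Probability.Probability"
begin

section \<open>Nonlinear Markov chains\<close>

text \<open>
  A measurable space is given by a measure \<open>M\<close> of which only \<open>space M\<close> and \<open>sets M\<close> are used.
  Probability measures on it are the elements of \<open>space (prob_algebra M)\<close>, and Markov kernels are
  the elements of \<open>M \<rightarrow>\<^sub>M prob_algebra M\<close>.
\<close>

definition tv_norm_diff :: "'a measure \<Rightarrow> 'a measure \<Rightarrow> real" where
  "tv_norm_diff \<mu> \<nu> = 2 * (SUP A\<in>sets \<mu>. measure \<mu> A - measure \<nu> A)"

primrec law :: "('a measure \<Rightarrow> 'a \<Rightarrow> 'a measure) \<Rightarrow> 'a measure \<Rightarrow> nat \<Rightarrow> 'a measure" where
  "law P \<mu> 0 = \<mu>"
| "law P \<mu> (Suc n) = law P \<mu> n \<bind> P (law P \<mu> n)"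

primrec step_kernel ::
  "'a measure \<Rightarrow> ('a measure \<Rightarrow> 'a \<Rightarrow> 'a measure) \<Rightarrow> 'a measure \<Rightarrow> nat \<Rightarrow> 'a \<Rightarrow> 'a measure" where
  "step_kernel M P \<mu> 0 x = return M x"
| "step_kernel M P \<mu> (Suc k) x = step_kernel M P \<mu> k x \<bind> P (law P \<mu> k)"

section \<open>The coupling operator of a linear kernel\<close>

text \<open>
  The dominating measure \<open>\<Lambda>\<close> may depend on the pair \<open>(x1, x2)\<close>, hence \<open>L x1 x2\<close> below. Any
  sigma-finite choice is allowed; the values of \<open>kappa\<close> and \<open>V_op\<close> do not depend on it.
\<close>

definition dominating ::
  "'a measure \<Rightarrow> ('a \<Rightarrow> 'a measure) \<Rightarrow> ('a \<Rightarrow> 'a \<Rightarrow> 'a measure) \<Rightarrow> bool" where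
  "dominating M Q L \<longleftrightarrow>
    (\<forall>x1\<in>space M. \<forall>x2\<in>space M.
       sigma_finite_measure (L x1 x2) \<and> sets (L x1 x2) = sets M \<and>
       absolutely_continuous (L x1 x2) (Q x1) \<and> absolutely_continuous (L x1 x2) (Q x2))"

definition dens :: "'a measure \<Rightarrow> 'a measure \<Rightarrow> 'a \<Rightarrow> real" where
  "dens \<Lambda> \<mu> u = enn2real (RN_deriv \<Lambda> \<mu> u)"

definition kappa :: "('a \<Rightarrow> 'a \<Rightarrow> 'a measure) \<Rightarrow> ('a \<Rightarrow> 'a measure) \<Rightarrow> 'a \<Rightarrow> 'a \<Rightarrow> real" where
  "kappa L Q x1 x2 = (\<integral>u. min (dens (L x1 x2) (Q x1) u) (dens (L x1 x2) (Q x2) u) \<partial>L x1 x2)"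

text \<open>\<open>phi L Q x1 x2 x\<close> is meant for \<open>x = x1\<close> and \<open>x = x2\<close>, and for \<open>kappa L Q x1 x2 < 1\<close>.\<close>

definition phi ::
  "('a \<Rightarrow> 'a \<Rightarrow> 'a measure) \<Rightarrow> ('a \<Rightarrow> 'a measure) \<Rightarrow> 'a \<Rightarrow> 'a \<Rightarrow> 'a \<Rightarrow> 'a \<Rightarrow> real" where
  "phi L Q x1 x2 x u =
     (dens (L x1 x2) (Q x) u - min (dens (L x1 x2) (Q x1) u) (dens (L x1 x2) (Q x2) u))
       / (1 - kappa L Q x1 x2)"

definition V_op ::
  "('a \<Rightarrow> 'a \<Rightarrow> 'a measure) \<Rightarrow> ('a \<Rightarrow> 'a measure) \<Rightarrow> ('a \<times> 'a \<Rightarrow> real) \<Rightarrow> 'a \<times> 'a \<Rightarrow> real" where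
  "V_op L Q h = (\<lambda>(x1, x2).
     if kappa L Q x1 x2 = 1 then 0
     else (1 - kappa L Q x1 x2) *
       (\<integral>u2. (\<integral>u1. h (u1, u2) * phi L Q x1 x2 x1 u1 * phi L Q x1 x2 x2 u2 \<partial>L x1 x2) \<partial>L x1 x2))"

section \<open>Spectral radius on the space of bounded measurable functions\<close>

definition bdd_measurable :: "'b measure \<Rightarrow> ('b \<Rightarrow> 'c::real_normed_vector) set" where
  "bdd_measurable N = {h \<in> borel_measurable N. bounded (h ` space N)}"

definition sup_norm :: "'b measure \<Rightarrow> ('b \<Rightarrow> 'c::real_normed_vector) \<Rightarrow> real" where
  "sup_norm N h = (SUP p\<in>space N. norm (h p))"

text \<open>
  Functions are total, so elements of the Banach space of bounded measurable complex functions
  are represented up to their values outside \<open>space N\<close>; equations are required on \<open>space N\<close> only.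
\<close>

definition bdd_linear_op :: "'b measure \<Rightarrow> (('b \<Rightarrow> complex) \<Rightarrow> 'b \<Rightarrow> complex) \<Rightarrow> bool" where
  "bdd_linear_op N T \<longleftrightarrow>
     (\<forall>h\<in>bdd_measurable N. T h \<in> bdd_measurable N) \<and>
     (\<forall>h\<in>bdd_measurable N. \<forall>g\<in>bdd_measurable N. \<forall>p\<in>space N.
        T (\<lambda>q. h q + g q) p = T h p + T g p) \<and>
     (\<forall>c. \<forall>h\<in>bdd_measurable N. \<forall>p\<in>space N. T (\<lambda>q. c * h q) p = c * T h p) \<and>
     (\<exists>K. \<forall>h\<in>bdd_measurable N. sup_norm N (T h) \<le> K * sup_norm N h)"

definition op_spectrum :: "'b measure \<Rightarrow> (('b \<Rightarrow> complex) \<Rightarrow> 'b \<Rightarrow> complex) \<Rightarrow> complex set" where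
  "op_spectrum N T = {z. \<not> (\<exists>S. bdd_linear_op N S \<and>
     (\<forall>h\<in>bdd_measurable N. \<forall>p\<in>space N.
        S (\<lambda>q. z * h q - T h q) p = h p \<and> z * S h p - T (S h) p = h p))}"

definition complexification ::
  "(('b \<Rightarrow> real) \<Rightarrow> 'b \<Rightarrow> real) \<Rightarrow> ('b \<Rightarrow> complex) \<Rightarrow> 'b \<Rightarrow> complex" where
  "complexification T h p = Complex (T (\<lambda>q. Re (h q)) p) (T (\<lambda>q. Im (h q)) p)"

text \<open>As usual, the spectrum of an operator on a real space is that of its complexification.\<close>

definition op_spectral_radius :: "'b measure \<Rightarrow> (('b \<Rightarrow> real) \<Rightarrow> 'b \<Rightarrow> real) \<Rightarrow> real" where
  "op_spectral_radius N T = (SUP z\<in>op_spectrum N (complexification T). norm z)"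

section \<open>Conditions on the family of kernels\<close>

text \<open>
  Densities are determined only up to null sets, so the pointwise bound is stated almost everywhere;
  equivalently, some version of the density satisfies it everywhere.
\<close>

definition close_kernels ::
  "'a measure \<Rightarrow> ('a \<Rightarrow> 'a measure) \<Rightarrow> ('a measure \<Rightarrow> 'a \<Rightarrow> 'a measure) \<Rightarrow> real \<Rightarrow> bool" where
  "close_kernels M Q P \<gamma> \<longleftrightarrow>
     (\<forall>x\<in>space M. \<forall>\<mu>\<in>space (prob_algebra M).
        absolutely_continuous (Q x) (P \<mu> x) \<and> absolutely_continuous (P \<mu> x) (Q x) \<and>
        (AE y in P \<mu> x. RN_deriv (P \<mu> x) (Q x) y \<le> ennreal (1 + \<gamma>)))"

definition tv_lipschitz ::
  "'a measure \<Rightarrow> ('a measure \<Rightarrow> 'a \<Rightarrow> 'a measure) \<Rightarrow> nat \<Rightarrow> real \<Rightarrow> bool" where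
  "tv_lipschitz M P k c \<longleftrightarrow>
     (\<forall>x\<in>space M. \<forall>\<mu>\<in>space (prob_algebra M). \<forall>\<nu>\<in>space (prob_algebra M).
        tv_norm_diff (step_kernel M P \<mu> k x) (step_kernel M P \<nu> k x) \<le> c * tv_norm_diff \<mu> \<nu>)"

end

theory Submission
  imports Defs
begin

text \<open>
  The operator \<open>V\<close> is positive, so for every \<open>s\<close> above its spectral radius the resolvent applied to
  the constant \<open>1\<close> is nonnegative; up to scaling it is a function \<open>w\<close> with \<open>1 \<le> w \<le> K\<close> and
  \<open>V w \<le> \<theta> w\<close> for some \<open>\<theta> < s\<close>. Let \<open>F\<close> be the set of \<open>f\<close> with \<open>f x - f y \<le> w (x, y)\<close>.
  Since \<open>Q f x - Q f y\<close> is \<open>V\<close> applied to \<open>f u - f v\<close>, the linear kernel maps \<open>F\<close> into \<open>\<theta> F\<close>.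
  The bound on the densities makes \<open>P \<mu>\<close> a mixture of \<open>Q\<close> and a kernel of weight at most \<open>\<gamma>\<close>, so
  \<open>P \<mu>\<close> maps \<open>F\<close> into \<open>(\<theta> + K \<gamma>) F\<close>, and the dependence on \<open>\<mu>\<close> costs \<open>K \<lambda>\<^sub>1\<close>. Hence the distance
  dual to \<open>F\<close>, which is equivalent to total variation, contracts by \<open>\<theta> + K \<gamma> + K \<lambda>\<^sub>1 \<le> s\<close> in each step.
\<close>

section \<open>Bounded operators and their resolvents\<close>

lemma bdd_measurableI:
  assumes "h \<in> borel_measurable N" "\<And>p. p \<in> space N \<Longrightarrow> norm (h p) \<le> c"
  shows "h \<in> bdd_measurable N"
  using assms unfolding bdd_measurable_def bounded_iff by auto

lemma bdd_measurable_measurable: "h \<in> bdd_measurable N \<Longrightarrow> h \<in> borel_measurable N"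
  by (simp add: bdd_measurable_def)

lemma norm_le_sup_norm:
  assumes "h \<in> bdd_measurable N" "p \<in> space N"
  shows "norm (h p) \<le> sup_norm N h"
  unfolding sup_norm_def
proof (rule cSUP_upper[OF assms(2)])
  show "bdd_above ((\<lambda>p. norm (h p)) ` space N)"
    using assms(1) unfolding bdd_measurable_def bounded_iff bdd_above_def by auto
qed

lemma sup_norm_le:
  assumes "space N \<noteq> {}" "\<And>p. p \<in> space N \<Longrightarrow> norm (h p) \<le> c"
  shows "sup_norm N h \<le> c"
  unfolding sup_norm_def using assms by (intro cSUP_least) auto

lemma sup_norm_nonneg:
  assumes "space N \<noteq> {}" "h \<in> bdd_measurable N"
  shows "0 \<le> sup_norm N h"
  using assms norm_le_sup_norm[OF assms(2)] norm_ge_zero order_trans by blast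

lemma bdd_measurable_const: "(\<lambda>_. c) \<in> bdd_measurable N"
  by (rule bdd_measurableI[of _ _ "norm c"]) auto

lemma bdd_measurable_add:
  fixes h g :: "'b \<Rightarrow> 'c::{real_normed_vector, second_countable_topology}"
  assumes "h \<in> bdd_measurable N" "g \<in> bdd_measurable N"
  shows "(\<lambda>q. h q + g q) \<in> bdd_measurable N"
proof (rule bdd_measurableI[of _ _ "sup_norm N h + sup_norm N g"])
  show "(\<lambda>q. h q + g q) \<in> borel_measurable N"
    using assms[THEN bdd_measurable_measurable] by measurable
  show "norm (h p + g p) \<le> sup_norm N h + sup_norm N g" if "p \<in> space N" for p
    using norm_le_sup_norm[OF assms(1) that] norm_le_sup_norm[OF assms(2) that] norm_triangle_ineq[of "h p" "g p"]
    by linarith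
qed

lemma bdd_measurable_mult_left:
  fixes h :: "'b \<Rightarrow> 'c::{real_normed_field, second_countable_topology}"
  assumes "h \<in> bdd_measurable N"
  shows "(\<lambda>q. c * h q) \<in> bdd_measurable N"
proof (rule bdd_measurableI[of _ _ "norm c * sup_norm N h"])
  show "(\<lambda>q. c * h q) \<in> borel_measurable N"
    using assms[THEN bdd_measurable_measurable] by measurable
  show "norm (c * h p) \<le> norm c * sup_norm N h" if "p \<in> space N" for p
    using norm_le_sup_norm[OF assms(1) that] by (simp add: norm_mult mult_left_mono)
qed

lemma bdd_measurable_diff:
  fixes h g :: "'b \<Rightarrow> 'c::{real_normed_field, second_countable_topology}"
  assumes "h \<in> bdd_measurable N" "g \<in> bdd_measurable N"
  shows "(\<lambda>q. h q - g q) \<in> bdd_measurable N"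
  using bdd_measurable_add[OF assms(1) bdd_measurable_mult_left[OF assms(2), of "-1"]] by simp

lemma bdd_measurable_Re: "h \<in> bdd_measurable N \<Longrightarrow> (\<lambda>q. Re (h q)) \<in> bdd_measurable N"
  using norm_le_sup_norm[of h N]
  by (intro bdd_measurableI[of _ _ "sup_norm N h"])
    (auto dest: bdd_measurable_measurable intro: order_trans[OF abs_Re_le_cmod])

lemma bdd_measurable_Im: "h \<in> bdd_measurable N \<Longrightarrow> (\<lambda>q. Im (h q)) \<in> bdd_measurable N"
  using norm_le_sup_norm[of h N]
  by (intro bdd_measurableI[of _ _ "sup_norm N h"])
    (auto dest: bdd_measurable_measurable intro: order_trans[OF abs_Im_le_cmod])

lemma bdd_measurable_of_real:
  assumes "h \<in> bdd_measurable N"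
  shows "(\<lambda>q. complex_of_real (h q)) \<in> bdd_measurable N"
  using assms norm_le_sup_norm[of h N]
  by (intro bdd_measurableI[of _ _ "sup_norm N h"]) (auto dest: bdd_measurable_measurable)

text \<open>The bound is stated pointwise with an arbitrary \<open>c\<close> rather than with
  \<open>sup_norm\<close>, so that any known bound on \<open>h\<close> can be plugged in; the case
  \<open>c = 0\<close> also makes \<open>T\<close> insensitive to values outside
  \<open>space N\<close>.\<close>

locale bounded_operator =
  fixes N :: "'b measure" and T :: "('b \<Rightarrow> complex) \<Rightarrow> 'b \<Rightarrow> complex" and K :: real
  assumes ne: "space N \<noteq> {}"
    and K_nonneg: "0 \<le> K"
    and T_mem: "h \<in> bdd_measurable N \<Longrightarrow> T h \<in> bdd_measurable N"
    and T_add: "\<lbrakk>h \<in> bdd_measurable N; g \<in> bdd_measurable N; p \<in> space N\<rbrakk>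
      \<Longrightarrow> T (\<lambda>q. h q + g q) p = T h p + T g p"
    and T_scale: "\<lbrakk>h \<in> bdd_measurable N; p \<in> space N\<rbrakk> \<Longrightarrow> T (\<lambda>q. a * h q) p = a * T h p"
    and T_bound: "\<lbrakk>h \<in> bdd_measurable N; \<And>p. p \<in> space N \<Longrightarrow> norm (h p) \<le> c; p \<in> space N\<rbrakk>
      \<Longrightarrow> norm (T h p) \<le> K * c"
begin

lemma T_diff:
  assumes "h \<in> bdd_measurable N" "g \<in> bdd_measurable N" "p \<in> space N"
  shows "T (\<lambda>q. h q - g q) p = T h p - T g p"
  using T_add[OF assms(1) bdd_measurable_mult_left[OF assms(2), of "-1"] assms(3)]
    T_scale[OF assms(2,3), of "-1"] by simp

text \<open>The difference of the two arguments is bounded by 0 on \<open>space N\<close>, so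
  \<open>T_bound\<close> with \<open>c = 0\<close> annihilates it.\<close>

lemma T_cong:
  assumes "h \<in> bdd_measurable N" "g \<in> bdd_measurable N" "p \<in> space N"
    and "\<And>q. q \<in> space N \<Longrightarrow> h q = g q"
  shows "T h p = T g p"
  using T_bound[OF bdd_measurable_diff[OF assms(1,2)], of 0 p] T_diff[OF assms(1-3)] assms(3,4) by simp

section \<open>Iterates of a bounded operator\<close>

lemma iter_mem: "h \<in> bdd_measurable N \<Longrightarrow> (T ^^ k) h \<in> bdd_measurable N"
  by (induction k) (auto intro: T_mem)

lemma iter_add:
  assumes "h \<in> bdd_measurable N" "g \<in> bdd_measurable N" "p \<in> space N"
  shows "(T ^^ k) (\<lambda>q. h q + g q) p = (T ^^ k) h p + (T ^^ k) g p"
  using assms(3)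
proof (induction k arbitrary: p)
  case (Suc k)
  have "T ((T ^^ k) (\<lambda>q. h q + g q)) p = T (\<lambda>q. (T ^^ k) h q + (T ^^ k) g q) p"
    using Suc assms by (intro T_cong bdd_measurable_add iter_mem) auto
  also have "\<dots> = T ((T ^^ k) h) p + T ((T ^^ k) g) p"
    using Suc.prems assms(1,2) by (intro T_add iter_mem)
  finally show ?case by simp
qed simp

lemma iter_scale:
  assumes "h \<in> bdd_measurable N" "p \<in> space N"
  shows "(T ^^ k) (\<lambda>q. c * h q) p = c * (T ^^ k) h p"
  using assms(2)
proof (induction k arbitrary: p)
  case (Suc k)
  have "T ((T ^^ k) (\<lambda>q. c * h q)) p = T (\<lambda>q. c * (T ^^ k) h q) p"
    using Suc assms by (intro T_cong bdd_measurable_mult_left iter_mem) auto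
  also have "\<dots> = c * T ((T ^^ k) h) p"
    by (rule T_scale[OF iter_mem[OF assms(1)] Suc.prems])
  finally show ?case by simp
qed simp

lemma iter_bound:
  assumes "h \<in> bdd_measurable N" "p \<in> space N"
  shows "norm ((T ^^ k) h p) \<le> K ^ k * sup_norm N h"
  using assms(2)
proof (induction k arbitrary: p)
  case 0 then show ?case using norm_le_sup_norm[OF assms(1)] by simp
next
  case (Suc k)
  have "norm (T ((T ^^ k) h) p) \<le> K * (K ^ k * sup_norm N h)"
    using Suc by (intro T_bound iter_mem assms) auto
  then show ?case by (simp add: mult.assoc)
qed

lemma T_sum:
  assumes "finite I" "\<And>i. i \<in> I \<Longrightarrow> f i \<in> bdd_measurable N"
  shows "(\<lambda>q. \<Sum>i\<in>I. f i q) \<in> bdd_measurable N \<and>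
    (\<forall>p\<in>space N. T (\<lambda>q. \<Sum>i\<in>I. f i q) p = (\<Sum>i\<in>I. T (f i) p))"
  using assms
proof (induction I)
  case empty
  have "T (\<lambda>q. 0) p = 0" if "p \<in> space N" for p
    using T_bound[OF bdd_measurable_const, of 0 0 p] that by simp
  then show ?case by (simp add: bdd_measurable_const)
next
  case (insert i I)
  then show ?case by (auto intro!: bdd_measurable_add simp: T_add)
qed

text \<open>The Neumann series of \<open>(z - T)\<close> inverse, summed pointwise; it converges
  once the norm of \<open>z\<close> exceeds \<open>K\<close>.\<close>

definition neumann :: "complex \<Rightarrow> ('b \<Rightarrow> complex) \<Rightarrow> 'b \<Rightarrow> complex" where
  "neumann z h p = (\<Sum>k. (T ^^ k) h p / z ^ Suc k)"

context
  fixes z :: complex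
  assumes z: "K < norm z"
begin

lemma z_nz: "z \<noteq> 0"
  using z K_nonneg by auto

lemma ratio: "0 \<le> K / norm z" "K / norm z < 1"
  using z K_nonneg z_nz by (auto simp: divide_less_eq)

lemma geometric_summable: "summable (\<lambda>k. (K / norm z) ^ k * c)"
  using ratio by (intro summable_mult2 summable_geometric) auto

lemma neumann_term_bound:
  assumes "h \<in> bdd_measurable N" "p \<in> space N"
  shows "norm ((T ^^ k) h p / z ^ Suc k) \<le> (K / norm z) ^ k * (sup_norm N h / norm z)"
  using divide_right_mono[OF iter_bound[OF assms, of k], of "norm z ^ Suc k"]
  by (simp add: norm_divide norm_mult norm_power power_divide mult_ac)

lemma neumann_summable_norm:
  assumes "h \<in> bdd_measurable N" "p \<in> space N"
  shows "summable (\<lambda>k. norm ((T ^^ k) h p / z ^ Suc k))"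
  by (rule summable_comparison_test'[OF geometric_summable[of "sup_norm N h / norm z"], of 0])
     (use neumann_term_bound[OF assms] in simp)

lemma neumann_summable:
  assumes "h \<in> bdd_measurable N" "p \<in> space N"
  shows "summable (\<lambda>k. (T ^^ k) h p / z ^ Suc k)"
  using neumann_summable_norm[OF assms] by (rule summable_norm_cancel)

text \<open>The sum of the geometric series with ratio \<open>K / norm z\<close> and first term
  \<open>1 / norm z\<close>.\<close>

definition neumann_bound :: real where
  "neumann_bound = 1 / (norm z - K)"

lemma neumann_norm_le:
  assumes "h \<in> bdd_measurable N" "p \<in> space N"
  shows "norm (neumann z h p) \<le> neumann_bound * sup_norm N h"
proof -
  have "norm (neumann z h p) \<le> (\<Sum>k. norm ((T ^^ k) h p / z ^ Suc k))"
    unfolding neumann_def by (rule summable_norm[OF neumann_summable_norm[OF assms]])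
  also have "\<dots> \<le> (\<Sum>k. (K / norm z) ^ k * (sup_norm N h / norm z))"
    using neumann_term_bound[OF assms]
    by (intro suminf_le geometric_summable neumann_summable_norm assms)
  also have "\<dots> = (1 / (1 - K / norm z)) * (sup_norm N h / norm z)"
    using ratio by (subst suminf_mult2[symmetric]) (auto simp: suminf_geometric intro!: summable_geometric)
  also have "\<dots> = neumann_bound * sup_norm N h"
    using z K_nonneg z_nz by (simp add: neumann_bound_def field_simps)
  finally show ?thesis .
qed

lemma neumann_mem:
  assumes "h \<in> bdd_measurable N"
  shows "neumann z h \<in> bdd_measurable N"
proof (rule bdd_measurableI[OF _ neumann_norm_le[OF assms]])
  have [measurable]: "(T ^^ k) h \<in> borel_measurable N" for k
    by (intro bdd_measurable_measurable iter_mem assms)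
  show "neumann z h \<in> borel_measurable N"
    unfolding neumann_def by measurable
qed

lemma neumann_add:
  assumes "h \<in> bdd_measurable N" "g \<in> bdd_measurable N" "p \<in> space N"
  shows "neumann z (\<lambda>q. h q + g q) p = neumann z h p + neumann z g p"
  unfolding neumann_def
  using suminf_add[OF neumann_summable[OF assms(1,3)] neumann_summable[OF assms(2,3)]]
  by (simp add: iter_add[OF assms] add_divide_distrib)

lemma neumann_scale:
  assumes "h \<in> bdd_measurable N" "p \<in> space N"
  shows "neumann z (\<lambda>q. c * h q) p = c * neumann z h p"
  unfolding neumann_def
  using suminf_mult[OF neumann_summable[OF assms], of c]
  by (simp add: iter_scale[OF assms])

lemma neumann_diff:
  assumes "h \<in> bdd_measurable N" "g \<in> bdd_measurable N" "p \<in> space N"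
  shows "neumann z (\<lambda>q. h q - g q) p = neumann z h p - neumann z g p"
  using neumann_add[OF assms(1) bdd_measurable_mult_left[OF assms(2), of "-1"] assms(3)]
    neumann_scale[OF assms(2,3), of "-1"] by simp

text \<open>The tail of the series is again a Neumann series, started from the \<open>n\<close>-th
  iterate. The case \<open>n = 1\<close> is the resolvent equation, general \<open>n\<close>
  supplies the remainder term for commuting with \<open>T\<close>.\<close>

lemma neumann_shift:
  assumes "h \<in> bdd_measurable N" "p \<in> space N"
  shows "neumann z h p = (\<Sum>k<n. (T ^^ k) h p / z ^ Suc k) + neumann z ((T ^^ n) h) p / z ^ n"
proof -
  have "neumann z ((T ^^ n) h) p / z ^ n = (\<Sum>k. (T ^^ k) ((T ^^ n) h) p / z ^ Suc k / z ^ n)"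
    unfolding neumann_def by (rule suminf_divide[OF neumann_summable[OF iter_mem[OF assms(1)] assms(2)], symmetric])
  also have "\<dots> = (\<Sum>k. (T ^^ (k + n)) h p / z ^ Suc (k + n))"
    by (simp add: funpow_add power_add mult.assoc)
  finally show ?thesis
    unfolding neumann_def
    using suminf_split_initial_segment[OF neumann_summable[OF assms], of n] by simp
qed

text \<open>\<open>T\<close> is continuous for the sup-norm only, so it cannot be moved through a
  pointwise series directly. Instead it is applied to a finite partial sum plus remainder, and the
  image of the remainder decays like \<open>(K / norm z) ^ n\<close>.\<close>

lemma T_neumann:
  assumes h: "h \<in> bdd_measurable N" and p: "p \<in> space N"
  shows "T (neumann z h) p = neumann z (T h) p"
proof -
  let ?s = "\<lambda>n. \<Sum>k<n. (T ^^ k) (T h) p / z ^ Suc k"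
  have rem: "norm (T (neumann z h) p - ?s n)
      \<le> K * neumann_bound * sup_norm N h * (K / norm z) ^ n" for n
  proof -
    have mem: "neumann z ((T ^^ n) h) \<in> bdd_measurable N"
      by (intro neumann_mem iter_mem h)
    have sum: "T (\<lambda>q. \<Sum>k<n. 1 / z ^ Suc k * (T ^^ k) h q) p = ?s n"
      "(\<lambda>q. \<Sum>k<n. 1 / z ^ Suc k * (T ^^ k) h q) \<in> bdd_measurable N"
    proof -
      have mem: "(\<lambda>q. 1 / z ^ Suc k * (T ^^ k) h q) \<in> bdd_measurable N" for k
        by (intro bdd_measurable_mult_left iter_mem h)
      show "(\<lambda>q. \<Sum>k<n. 1 / z ^ Suc k * (T ^^ k) h q) \<in> bdd_measurable N"
        by (rule T_sum[OF finite_lessThan mem, THEN conjunct1])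
      have "T (\<lambda>q. \<Sum>k<n. 1 / z ^ Suc k * (T ^^ k) h q) p
          = (\<Sum>k<n. T (\<lambda>q. 1 / z ^ Suc k * (T ^^ k) h q) p)"
        using T_sum[of "{..<n}" "\<lambda>k q. 1 / z ^ Suc k * (T ^^ k) h q"] mem p by blast
      also have "\<dots> = ?s n"
        by (intro sum.cong refl) (subst T_scale[OF iter_mem[OF h] p], simp add: funpow_swap1)
      finally show "T (\<lambda>q. \<Sum>k<n. 1 / z ^ Suc k * (T ^^ k) h q) p = ?s n" .
    qed
    have "T (neumann z h) p
        = T (\<lambda>q. (\<Sum>k<n. 1 / z ^ Suc k * (T ^^ k) h q) + 1 / z ^ n * neumann z ((T ^^ n) h) q) p"
      using neumann_shift[OF h, of _ n]
      by (intro T_cong neumann_mem h p bdd_measurable_add sum bdd_measurable_mult_left mem) simp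
    also have "\<dots> = ?s n + 1 / z ^ n * T (neumann z ((T ^^ n) h)) p"
      by (simp only: T_add[OF sum(2) bdd_measurable_mult_left[OF mem] p] T_scale[OF mem p] sum(1))
    finally have "norm (T (neumann z h) p - ?s n) = norm (T (neumann z ((T ^^ n) h)) p) / norm z ^ n"
      by (simp add: norm_mult norm_divide norm_power)
    also have "\<dots> \<le> K * (neumann_bound * (K ^ n * sup_norm N h)) / norm z ^ n"
    proof (intro divide_right_mono T_bound mem p)
      fix q assume q: "q \<in> space N"
      \<comment> \<open>The growth \<open>K ^ n\<close> of the iterate competes with the factor
        \<open>1 / norm z ^ n\<close> of the remainder.\<close>
      have "sup_norm N ((T ^^ n) h) \<le> K ^ n * sup_norm N h"
        using iter_bound[OF h] by (intro sup_norm_le ne)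
      then have "neumann_bound * sup_norm N ((T ^^ n) h) \<le> neumann_bound * (K ^ n * sup_norm N h)"
        using z by (intro mult_left_mono) (auto simp: neumann_bound_def)
      then show "norm (neumann z ((T ^^ n) h) q) \<le> neumann_bound * (K ^ n * sup_norm N h)"
        using neumann_norm_le[OF iter_mem[OF h] q, of n] by linarith
    qed simp
    finally show ?thesis by (simp add: power_divide mult_ac)
  qed
  have "(\<lambda>n. K * neumann_bound * sup_norm N h * (K / norm z) ^ n) \<longlonglongrightarrow> K * neumann_bound * sup_norm N h * 0"
    using ratio by (intro tendsto_mult tendsto_const LIMSEQ_power_zero) auto
  then have "(\<lambda>n. K * neumann_bound * sup_norm N h * (K / norm z) ^ n) \<longlonglongrightarrow> 0"
    by simp
  then have "(\<lambda>n. T (neumann z h) p - ?s n) \<longlonglongrightarrow> 0"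
    by (rule Lim_null_comparison[rotated]) (intro always_eventually allI rem)
  from tendsto_diff[OF tendsto_const[of "T (neumann z h) p"] this]
  have "?s \<longlonglongrightarrow> T (neumann z h) p"
    by simp
  moreover have "?s \<longlonglongrightarrow> neumann z (T h) p"
    unfolding neumann_def by (intro summable_LIMSEQ neumann_summable T_mem h p)
  ultimately show ?thesis by (rule LIMSEQ_unique)
qed

lemma neumann_resolvent:
  assumes "h \<in> bdd_measurable N" "p \<in> space N"
  shows "z * neumann z h p - neumann z (T h) p = h p"
  using neumann_shift[OF assms, of 1] z_nz by (simp add: field_simps)

text \<open>The Neumann series is a bounded inverse of \<open>z - T\<close> on both sides: one side
  is the resolvent equation, the other follows from it because the series commutes with
  \<open>T\<close>.\<close>

lemma not_in_spectrum: "z \<notin> op_spectrum N T"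
proof -
  have "bdd_linear_op N (neumann z)"
    unfolding bdd_linear_op_def
    using neumann_norm_le by (auto intro!: neumann_mem neumann_add neumann_scale sup_norm_le ne exI[of _ neumann_bound])
  moreover have "neumann z (\<lambda>q. z * h q - T h q) p = h p" "z * neumann z h p - T (neumann z h) p = h p"
    if h: "h \<in> bdd_measurable N" and p: "p \<in> space N" for h p
    using neumann_resolvent[OF h p] T_neumann[OF h p] neumann_scale[OF h p, of z]
      neumann_diff[OF bdd_measurable_mult_left[OF h, of z] T_mem[OF h] p] by auto
  ultimately show ?thesis
    unfolding op_spectrum_def by blast
qed

end

text \<open>Makes the \<open>SUP\<close> in the spectral radius a genuine upper bound for the norms
  of spectral values.\<close>

lemma bdd_above_spectrum: "bdd_above (norm ` op_spectrum N T)"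
  using not_in_spectrum by (intro bdd_aboveI[of _ K]) force

end

section \<open>The spectral radius of a positive operator\<close>

text \<open>Boundedness is not among the axioms: positivity and linearity bound \<open>V\<close> by
  the supremum of its value on the constant 1.\<close>

locale positive_operator =
  fixes N :: "'b measure" and V :: "('b \<Rightarrow> real) \<Rightarrow> 'b \<Rightarrow> real"
  assumes ne: "space N \<noteq> {}"
    and V_mem: "h \<in> bdd_measurable N \<Longrightarrow> V h \<in> bdd_measurable N"
    and V_add: "\<lbrakk>h \<in> bdd_measurable N; g \<in> bdd_measurable N; p \<in> space N\<rbrakk>
      \<Longrightarrow> V (\<lambda>q. h q + g q) p = V h p + V g p"
    and V_scale: "\<lbrakk>h \<in> bdd_measurable N; p \<in> space N\<rbrakk> \<Longrightarrow> V (\<lambda>q. c * h q) p = c * V h p"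
    and V_nonneg: "\<lbrakk>h \<in> bdd_measurable N; \<And>q. q \<in> space N \<Longrightarrow> 0 \<le> h q; p \<in> space N\<rbrakk> \<Longrightarrow> 0 \<le> V h p"
begin

lemma V_diff:
  assumes "h \<in> bdd_measurable N" "g \<in> bdd_measurable N" "p \<in> space N"
  shows "V (\<lambda>q. h q - g q) p = V h p - V g p"
  using V_add[OF assms(1) bdd_measurable_mult_left[OF assms(2), of "-1"] assms(3)]
    V_scale[OF assms(2,3), of "-1"] by simp

lemma V_mono:
  assumes "h \<in> bdd_measurable N" "g \<in> bdd_measurable N" "p \<in> space N"
    and "\<And>q. q \<in> space N \<Longrightarrow> h q \<le> g q"
  shows "V h p \<le> V g p"
  using V_nonneg[OF bdd_measurable_diff[OF assms(2,1)] _ assms(3)] V_diff[OF assms(2,1,3)] assms(4) by simp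

lemma V_const: "p \<in> space N \<Longrightarrow> V (\<lambda>_. c) p = c * V (\<lambda>_. 1) p"
  using V_scale[OF bdd_measurable_const[of 1], of p c] by simp

abbreviation B :: real where "B \<equiv> sup_norm N (V (\<lambda>_. 1))"

lemma V_one_le: "p \<in> space N \<Longrightarrow> V (\<lambda>_. 1) p \<le> B"
  using norm_le_sup_norm[OF V_mem[OF bdd_measurable_const], of p 1] by simp

lemma B_nonneg: "0 \<le> B"
  by (intro sup_norm_nonneg ne V_mem bdd_measurable_const)

text \<open>Positivity preserves the comparison of \<open>h\<close> with the constants
  \<open>c\<close> and \<open>- c\<close>.\<close>

lemma V_abs_le:
  assumes "h \<in> bdd_measurable N" "\<And>q. q \<in> space N \<Longrightarrow> \<bar>h q\<bar> \<le> c" "p \<in> space N"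
  shows "\<bar>V h p\<bar> \<le> B * c"
proof -
  have "0 \<le> c"
    using assms(2)[OF assms(3)] by linarith
  have "V h p \<le> V (\<lambda>_. c) p" "V (\<lambda>_. - c) p \<le> V h p"
    using assms by (auto intro!: V_mono bdd_measurable_const simp: abs_le_iff minus_le_iff)
  moreover have "c * V (\<lambda>_. 1) p \<le> c * B"
    using V_one_le[OF assms(3)] \<open>0 \<le> c\<close> by (rule mult_left_mono)
  ultimately show ?thesis
    using V_const[OF assms(3), of c] V_const[OF assms(3), of "- c"] by (simp add: mult.commute abs_le_iff)
qed

text \<open>The real and imaginary parts are each bounded with constant \<open>B\<close>, and the
  triangle inequality adds the two, hence \<open>2 * B\<close>.\<close>

sublocale cpl: bounded_operator N "complexification V" "2 * B"
proof
  fix h g :: "'b \<Rightarrow> complex" assume h: "h \<in> bdd_measurable N"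
  note hh = bdd_measurable_Re[OF h] bdd_measurable_Im[OF h]
  have bd: "norm (complexification V h p) \<le> 2 * B * c"
    if p: "p \<in> space N" and c: "\<And>p. p \<in> space N \<Longrightarrow> norm (h p) \<le> c" for p c
  proof -
    have "\<bar>V (\<lambda>q. Re (h q)) p\<bar> \<le> B * c" "\<bar>V (\<lambda>q. Im (h q)) p\<bar> \<le> B * c"
      using c abs_Re_le_cmod abs_Im_le_cmod order_trans by (intro V_abs_le hh p; blast)+
    then show ?thesis
      using cmod_le[of "complexification V h p"] by (simp add: complexification_def)
  qed
  then show "\<And>c p. \<lbrakk>\<And>p. p \<in> space N \<Longrightarrow> norm (h p) \<le> c; p \<in> space N\<rbrakk>
      \<Longrightarrow> norm (complexification V h p) \<le> 2 * B * c"
    by blast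
  have [measurable]: "V (\<lambda>q. Re (h q)) \<in> borel_measurable N" "V (\<lambda>q. Im (h q)) \<in> borel_measurable N"
    using hh[THEN V_mem, THEN bdd_measurable_measurable] by auto
  have eq: "complexification V h = (\<lambda>p. complex_of_real (V (\<lambda>q. Re (h q)) p) + \<i> * complex_of_real (V (\<lambda>q. Im (h q)) p))"
    by (auto simp: complexification_def complex_eq_iff)
  show "complexification V h \<in> bdd_measurable N"
  proof (rule bdd_measurableI)
    show "complexification V h \<in> borel_measurable N"
      unfolding eq by measurable
    show "norm (complexification V h p) \<le> 2 * B * sup_norm N h" if "p \<in> space N" for p
      by (rule bd[OF that norm_le_sup_norm[OF h]])
  qed
  fix p assume p: "p \<in> space N"
  show "complexification V (\<lambda>q. c * h q) p = c * complexification V h p" for c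
    by (simp add: complexification_def complex_eq_iff hh V_scale[OF hh(1) p] V_scale[OF hh(2) p] bdd_measurable_mult_left
        V_diff[OF bdd_measurable_mult_left[OF hh(1)] bdd_measurable_mult_left[OF hh(2)] p]
        V_add[OF bdd_measurable_mult_left[OF hh(1)] bdd_measurable_mult_left[OF hh(2)] p]
        V_add[OF bdd_measurable_mult_left[OF hh(2)] bdd_measurable_mult_left[OF hh(1)] p])
  assume g: "g \<in> bdd_measurable N"
  show "complexification V (\<lambda>q. h q + g q) p = complexification V h p + complexification V g p"
    by (simp add: complexification_def complex_eq_iff
        V_add[OF bdd_measurable_Re[OF h] bdd_measurable_Re[OF g] p]
        V_add[OF bdd_measurable_Im[OF h] bdd_measurable_Im[OF g] p])
qed (use ne B_nonneg in auto)

section \<open>Resolvents of a positive operator on the real axis\<close>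

lemma V_zero: "p \<in> space N \<Longrightarrow> V (\<lambda>_. 0) p = 0"
  using V_const[of p 0] by simp

text \<open>Such a \<open>g\<close> plays the role of the resolvent at \<open>s\<close> applied to
  the constant 1. A relation is used because functions are determined on \<open>space N\<close>
  only.\<close>

definition resolvent_at :: "real \<Rightarrow> ('b \<Rightarrow> real) \<Rightarrow> bool" where
  "resolvent_at s g \<longleftrightarrow> g \<in> bdd_measurable N \<and> (\<forall>p\<in>space N. s * g p - V g p = 1)"

lemma complexification_of_real:
  "p \<in> space N \<Longrightarrow> complexification V (\<lambda>q. complex_of_real (h q)) p = complex_of_real (V h p)"
  using V_zero by (simp add: complexification_def complex_eq_iff)

text \<open>If \<open>(t - V) g = 1\<close> then \<open>(s - V) g = 1 + (s - t) g\<close>, and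
  applying the bounded inverse of \<open>s - V\<close> recovers \<open>g\<close>. When
  \<open>K\<close> times the distance of \<open>s\<close> and \<open>t\<close> is at most one half,
  this bounds \<open>g\<close> by \<open>2 * K\<close>, uniformly in \<open>t\<close>.\<close>

lemma resolvent_local_bound:
  assumes "complex_of_real s \<notin> op_spectrum N (complexification V)"
  obtains g K where "resolvent_at s g" "0 < K"
    "\<And>t g. resolvent_at t g \<Longrightarrow> sup_norm N g \<le> K * (1 + \<bar>s - t\<bar> * sup_norm N g)"
proof -
  let ?T = "complexification V"
  obtain S where S: "bdd_linear_op N S"
    and inv: "\<And>h p. \<lbrakk>h \<in> bdd_measurable N; p \<in> space N\<rbrakk> \<Longrightarrow> S (\<lambda>q. of_real s * h q - ?T h q) p = h p"
      "\<And>h p. \<lbrakk>h \<in> bdd_measurable N; p \<in> space N\<rbrakk> \<Longrightarrow> of_real s * S h p - ?T (S h) p = h p"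
    using assms unfolding op_spectrum_def by blast
  have S_mem: "h \<in> bdd_measurable N \<Longrightarrow> S h \<in> bdd_measurable N" for h
    using S by (simp add: bdd_linear_op_def)
  obtain K0 where K0: "\<And>h. h \<in> bdd_measurable N \<Longrightarrow> sup_norm N (S h) \<le> K0 * sup_norm N h"
    using S unfolding bdd_linear_op_def by blast
  \<comment> \<open>The operator bound may be zero or negative; enlarging it is harmless since
    sup-norms are nonnegative.\<close>
  define K where "K = max K0 1"
  have K: "sup_norm N (S h) \<le> K * sup_norm N h" if "h \<in> bdd_measurable N" for h
    using K0[OF that] mult_right_mono[of K0 K, OF _ sup_norm_nonneg[OF ne that]] by (simp add: K_def)
  let ?g = "\<lambda>q. Re (S (\<lambda>_. 1) q)"
  have "?g \<in> bdd_measurable N"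
    by (intro bdd_measurable_Re S_mem bdd_measurable_const)
  moreover have "s * ?g p - V ?g p = 1" if "p \<in> space N" for p
    using arg_cong[OF inv(2)[OF bdd_measurable_const[of 1] that], of Re] by (simp add: complexification_def)
  ultimately have g: "resolvent_at s ?g"
    by (simp add: resolvent_at_def)
  have bd: "sup_norm N g \<le> K * (1 + \<bar>s - t\<bar> * sup_norm N g)" if t: "resolvent_at t g" for t g
  proof -
    let ?c = "\<lambda>q. complex_of_real (g q)"
    let ?u = "\<lambda>q. of_real s * ?c q - ?T ?c q"
    have gm: "g \<in> bdd_measurable N"
      using t by (simp add: resolvent_at_def)
    have cm: "?c \<in> bdd_measurable N"
      using gm by (rule bdd_measurable_of_real)
    have um: "?u \<in> bdd_measurable N"
      by (intro bdd_measurable_diff bdd_measurable_mult_left cpl.T_mem cm)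
    have ub: "sup_norm N ?u \<le> 1 + \<bar>s - t\<bar> * sup_norm N g"
    proof (rule sup_norm_le[OF ne])
      fix p assume p: "p \<in> space N"
      have "?u p = of_real (s * g p - V g p)"
        using complexification_of_real[OF p] by simp
      also have "s * g p - V g p = 1 + (s - t) * g p"
        using t p by (auto simp: resolvent_at_def algebra_simps)
      also have "norm (complex_of_real (1 + (s - t) * g p)) \<le> 1 + \<bar>s - t\<bar> * \<bar>g p\<bar>"
        unfolding norm_of_real using abs_triangle_ineq[of 1 "(s - t) * g p"] by (simp add: abs_mult)
      also have "\<dots> \<le> 1 + \<bar>s - t\<bar> * sup_norm N g"
        using norm_le_sup_norm[OF gm p] by (simp add: mult_left_mono)
      finally show "norm (?u p) \<le> 1 + \<bar>s - t\<bar> * sup_norm N g" .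
    qed
    have "sup_norm N g \<le> sup_norm N (S ?u)"
    proof (rule sup_norm_le[OF ne])
      fix p assume p: "p \<in> space N"
      show "norm (g p) \<le> sup_norm N (S ?u)"
        using norm_le_sup_norm[OF S_mem[OF um] p] inv(1)[OF cm p] by simp
    qed
    also have "\<dots> \<le> K * sup_norm N ?u"
      by (rule K[OF um])
    also have "\<dots> \<le> K * (1 + \<bar>s - t\<bar> * sup_norm N g)"
      using ub by (intro mult_left_mono) (auto simp: K_def)
    finally show ?thesis .
  qed
  show ?thesis
    by (rule that[OF g _ bd]) (auto simp: K_def)
qed

text \<open>A maximum principle with \<open>w\<close> as strict supersolution. Take the least
  \<open>c\<close> with \<open>- c * w \<le> g\<close>. If \<open>c\<close> were positive, applying
  \<open>V\<close> and the equation \<open>t * g = 1 + V g\<close> would improve it to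
  \<open>c * q / t\<close>, which is smaller.\<close>

lemma resolvent_nonneg:
  assumes g: "resolvent_at t g" and w: "w \<in> bdd_measurable N"
    and w_ge: "0 < \<epsilon>" "\<And>p. p \<in> space N \<Longrightarrow> \<epsilon> \<le> w p"
    and Vw: "\<And>p. p \<in> space N \<Longrightarrow> V w p \<le> q * w p"
    and t: "0 \<le> q" "q < t" and p: "p \<in> space N"
  shows "0 \<le> g p"
proof -
  have gm: "g \<in> bdd_measurable N" and eq: "\<And>p. p \<in> space N \<Longrightarrow> t * g p = 1 + V g p"
    using g by (auto simp: resolvent_at_def algebra_simps)
  have w_pos: "0 < w p" if "p \<in> space N" for p
    using w_ge that by (meson less_le_trans)
  define c where "c = (SUP p\<in>space N. - g p / w p)"
  \<comment> \<open>The uniform lower bound on \<open>w\<close> keeps the quotient bounded, so that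
    \<open>c\<close> is a genuine supremum.\<close>
  have "bdd_above ((\<lambda>p. - g p / w p) ` space N)"
  proof (rule bdd_aboveI2[of _ _ "sup_norm N g / \<epsilon>"])
    fix p assume p: "p \<in> space N"
    have "- g p / w p \<le> sup_norm N g / w p"
      using norm_le_sup_norm[OF gm p] w_pos[OF p] by (intro divide_right_mono) auto
    also have "\<dots> \<le> sup_norm N g / \<epsilon>"
      using w_ge p w_pos[OF p] sup_norm_nonneg[OF ne gm] by (intro divide_left_mono) auto
    finally show "- g p / w p \<le> sup_norm N g / \<epsilon>" .
  qed
  then have upper: "- g p / w p \<le> c" if "p \<in> space N" for p
    unfolding c_def using that by (rule cSUP_upper[rotated])
  then have low: "- c * w p \<le> g p" if "p \<in> space N" for p
    using that w_pos[OF that] by (fastforce simp: field_simps)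
  have "c \<le> 0"
  proof (rule ccontr)
    assume "\<not> c \<le> 0"
    then have c: "0 < c" by simp
    have "- g p / w p \<le> c * q / t" if p: "p \<in> space N" for p
    proof -
      have "- c * (q * w p) \<le> - c * V w p"
        using Vw[OF p] c by simp
      also have "\<dots> = V (\<lambda>q. - c * w q) p"
        using V_scale[OF w p, of "- c"] by simp
      also have "\<dots> \<le> V g p"
        using low by (intro V_mono bdd_measurable_mult_left w gm p)
      \<comment> \<open>The summand 1 in \<open>t * g p = 1 + V g p\<close> is dropped here; the
        strict gain comes from \<open>q < t\<close>.\<close>
      finally have "- (t * g p) \<le> c * (q * w p)"
        using eq[OF p] by simp
      then show ?thesis
        using w_pos[OF p] t by (simp add: field_simps)
    qed
    then have "c \<le> c * q / t"
      unfolding c_def by (intro cSUP_least ne)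
    moreover have "c * q / t < c"
      using c t by (simp add: field_simps)
    ultimately show False by simp
  qed
  then have "0 \<le> - c * w p"
    using w_pos[OF p] by (simp add: mult_nonpos_nonneg)
  then show ?thesis using low[OF p] by simp
qed

text \<open>In \<open>V g = s * g - 1\<close> the subtracted 1 is at least \<open>g / c\<close>,
  which turns the equation into a strict decay of \<open>g\<close>; the gain \<open>1 / c\<close>
  depends only on an upper bound for \<open>g\<close>. The lower bound on \<open>g\<close> comes
  from \<open>V g\<close> being nonnegative.\<close>

lemma resolvent_Lyapunov:
  assumes g: "resolvent_at s g" and nonneg: "\<And>p. p \<in> space N \<Longrightarrow> 0 \<le> g p" and s: "0 \<le> s"
    and c: "0 < c" "\<And>p. p \<in> space N \<Longrightarrow> g p \<le> c"
  shows "0 < s" "\<And>p. p \<in> space N \<Longrightarrow> 1 \<le> s * g p" "0 \<le> s - 1 / c"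
    "\<And>p. p \<in> space N \<Longrightarrow> V g p \<le> (s - 1 / c) * g p"
proof -
  have gm: "g \<in> bdd_measurable N" and eq: "\<And>p. p \<in> space N \<Longrightarrow> V g p = s * g p - 1"
    using g by (auto simp: resolvent_at_def algebra_simps)
  have Vg: "0 \<le> V g p" if "p \<in> space N" for p
    using V_nonneg[OF gm nonneg that] .
  then show ge: "1 \<le> s * g p" if "p \<in> space N" for p
    using eq[OF that] that by fastforce
  obtain p where p: "p \<in> space N" using ne by blast
  show "0 < s"
    using ge[OF p] s by (cases "s = 0") auto
  show le: "V g p \<le> (s - 1 / c) * g p" if "p \<in> space N" for p
  proof -
    have "g p / c \<le> 1"
      using c(2)[OF that] c(1) by (simp add: divide_le_eq)
    then show ?thesis
      using eq[OF that] by (simp add: left_diff_distrib)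
  qed
  have "0 < g p"
    using ge[OF p] nonneg[OF p] by (cases "g p = 0") auto
  then show "0 \<le> s - 1 / c"
    using order_trans[OF Vg[OF p] le[OF p]] by (auto simp: zero_le_mult_iff)
qed

lemma resolvent_exists:
  assumes "complex_of_real s \<notin> op_spectrum N (complexification V)"
  obtains g where "resolvent_at s g"
  using resolvent_local_bound[OF assms] by blast

text \<open>Nonnegativity of the resolvent is continued down the real axis: the local bound on the
  resolvent gives Lyapunov functions whose gain is bounded below near every point of the resolvent set.\<close>

lemma resolvent_nonneg_continuation:
  assumes s0: "0 \<le> s0"
    and res: "\<And>t. s0 \<le> t \<Longrightarrow> complex_of_real t \<notin> op_spectrum N (complexification V)"
    and g: "resolvent_at s0 g" and p: "p \<in> space N"
  shows "0 \<le> g p"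
proof -
  define A where "A = {s. s0 \<le> s \<and> (\<forall>t g. s \<le> t \<longrightarrow> resolvent_at t g \<longrightarrow> (\<forall>p\<in>space N. 0 \<le> g p))}"
  \<comment> \<open>Beyond \<open>B\<close> the constant 1 is already a supersolution, so the
    continuation has a starting point.\<close>
  have big: "max s0 (B + 1) \<in> A"
  proof -
    have "0 \<le> g p" if "max s0 (B + 1) \<le> t" "resolvent_at t g" "p \<in> space N" for t g p
    proof (rule resolvent_nonneg[OF that(2) bdd_measurable_const[of 1] zero_less_one _ _ B_nonneg _ that(3)])
      show "B < t" using that(1) by simp
      show "V (\<lambda>_. 1) q \<le> B * 1" if "q \<in> space N" for q
        using V_one_le[OF that] by simp
    qed simp
    then show ?thesis
      unfolding A_def by (intro CollectI conjI allI impI ballI max.cobounded1)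
  qed
  have bdd: "bdd_below A"
    by (rule bdd_belowI[of _ s0]) (auto simp: A_def)
  define \<rho> where "\<rho> = Inf A"
  have "A \<noteq> {}" using big by blast
  then have "s0 \<le> \<rho>"
    unfolding \<rho>_def by (rule cInf_greatest) (simp add: A_def)
  then obtain K where K: "0 < K"
    "\<And>t g. resolvent_at t g \<Longrightarrow> sup_norm N g \<le> K * (1 + \<bar>\<rho> - t\<bar> * sup_norm N g)"
    using resolvent_local_bound[OF res, of \<rho>] by metis
  \<comment> \<open>The infimum need not be attained, so a nearby \<open>s\<close> in
    \<open>A\<close> is used. Within distance \<open>1 / (4 * K)\<close> the local bound gives
    \<open>h \<le> 2 * K\<close>, hence a gain of \<open>1 / (2 * K)\<close>, enough to step from
    \<open>s\<close> to strictly below \<open>\<rho>\<close>.\<close>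
  have "\<rho> < \<rho> + 1 / (4 * K)" using K by simp
  then obtain s where s: "s \<in> A" "s < \<rho> + 1 / (4 * K)"
    unfolding \<rho>_def using cInf_lessD[OF \<open>A \<noteq> {}\<close>] by blast
  have "\<rho> \<le> s"
    unfolding \<rho>_def using s bdd by (intro cInf_lower)
  have "s0 \<le> s" using s by (simp add: A_def)
  obtain h where h: "resolvent_at s h"
    using resolvent_exists[OF res[OF \<open>s0 \<le> s\<close>]] .
  have hm: "h \<in> bdd_measurable N" using h by (simp add: resolvent_at_def)
  have h_nonneg: "0 \<le> h p" if "p \<in> space N" for p
    using s(1) h that by (auto simp: A_def)
  have "\<bar>\<rho> - s\<bar> * K \<le> 1 / 2"
    using \<open>\<rho> \<le> s\<close> s(2) K(1) by (simp add: field_simps)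
  then have "\<bar>\<rho> - s\<bar> * K * sup_norm N h \<le> 1 / 2 * sup_norm N h"
    by (rule mult_right_mono[OF _ sup_norm_nonneg[OF ne hm]])
  then have "sup_norm N h \<le> 2 * K"
    using K(2)[OF h] by (simp add: algebra_simps)
  then have h_le: "h p \<le> 2 * K" if "p \<in> space N" for p
    using norm_le_sup_norm[OF hm that] by simp
  note Ly = resolvent_Lyapunov[OF h h_nonneg _ _ h_le]
  have "0 \<le> s" "0 < 2 * K" using s0 \<open>s0 \<le> s\<close> K(1) by auto
  note Ly = Ly[OF _ this]
  let ?q = "s - 1 / (2 * K)"
  \<comment> \<open>The maximum principle with supersolution \<open>h\<close>, whose lower bound
    \<open>1 / s\<close> comes from \<open>1 \<le> s * h p\<close>.\<close>
  have pos: "0 \<le> g p" if "?q < t" "resolvent_at t g" "p \<in> space N" for t g p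
    using Ly that by (intro resolvent_nonneg[OF that(2) hm, of "1 / s" ?q]) (auto simp: field_simps)
  have "1 / (2 * K) = 1 / (4 * K) + 1 / (4 * K)"
    by simp
  with s(2) have "?q < \<rho> - 1 / (4 * K)"
    by linarith
  have "max s0 (\<rho> - 1 / (4 * K)) \<in> A"
    unfolding A_def
  proof (intro CollectI conjI allI impI ballI max.cobounded1)
    show "0 \<le> g p" if "max s0 (\<rho> - 1 / (4 * K)) \<le> t" "resolvent_at t g" "p \<in> space N" for t g p
      using that \<open>?q < \<rho> - 1 / (4 * K)\<close> by (intro pos[of t g p]) auto
  qed
  then have "\<rho> \<le> max s0 (\<rho> - 1 / (4 * K))"
    unfolding \<rho>_def using bdd by (intro cInf_lower)
  \<comment> \<open>A member of \<open>A\<close> below its infimum is impossible, so the maximum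
    must be \<open>s0\<close>: the continuation stops only at the end of the half-line.\<close>
  then have "\<rho> \<le> s0"
    using K(1) by (auto simp: max_def split: if_splits)
  then have "?q < s0"
    using \<open>?q < \<rho> - 1 / (4 * K)\<close> K(1) by (smt (verit) zero_less_divide_1_iff)
  then show ?thesis using pos g p by blast
qed

text \<open>Otherwise nonnegativity could be continued down to 0, giving a nonnegative
  \<open>g\<close> with \<open>V g = -1\<close>, against positivity. In particular the spectrum is
  nonempty, which is what makes the spectral radius nonnegative.\<close>

lemma spectrum_has_nonneg_real:
  obtains t where "0 \<le> t" "complex_of_real t \<in> op_spectrum N (complexification V)"
proof (rule ccontr)
  assume "\<not> thesis"
  then have res: "\<And>t. 0 \<le> t \<Longrightarrow> complex_of_real t \<notin> op_spectrum N (complexification V)"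
    using that by blast
  obtain g where g: "resolvent_at 0 g"
    using resolvent_exists[OF res[OF order_refl]] .
  obtain p where p: "p \<in> space N" using ne by blast
  have "0 \<le> g q" if "q \<in> space N" for q
    by (rule resolvent_nonneg_continuation[OF _ res g that]) auto
  then show False
    using V_nonneg[of g p] g p by (auto simp: resolvent_at_def)
qed

lemma spectral_radius_nonneg: "0 \<le> op_spectral_radius N V"
  and spectrum_le_spectral_radius:
    "z \<in> op_spectrum N (complexification V) \<Longrightarrow> norm z \<le> op_spectral_radius N V"
proof -
  show le: "z \<in> op_spectrum N (complexification V) \<Longrightarrow> norm z \<le> op_spectral_radius N V" for z
    unfolding op_spectral_radius_def by (rule cSUP_upper[OF _ cpl.bdd_above_spectrum])
  show "0 \<le> op_spectral_radius N V"
    using spectrum_has_nonneg_real le by (metis norm_ge_zero order_trans)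
qed

text \<open>The witness is \<open>s\<close> times the resolvent \<open>g\<close> at
  \<open>s\<close>: this scaling makes the lower bound equal to 1. With \<open>g \<le> c\<close> the
  constants are \<open>\<theta> = s - 1 / c\<close> and \<open>K = s * c\<close>.\<close>

lemma Lyapunov_function_exists:
  assumes "op_spectral_radius N V < s"
  obtains w \<theta> K where "w \<in> bdd_measurable N" "0 \<le> \<theta>" "\<theta> < s"
    "\<forall>p\<in>space N. 1 \<le> w p \<and> w p \<le> K \<and> V w p \<le> \<theta> * w p"
proof -
  have s: "0 \<le> s" using assms spectral_radius_nonneg by simp
  have res: "complex_of_real t \<notin> op_spectrum N (complexification V)" if "s \<le> t" for t
    using spectrum_le_spectral_radius[of "complex_of_real t"] that assms by auto
  obtain g where g: "resolvent_at s g"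
    using resolvent_exists[OF res[OF order_refl]] .
  have gm: "g \<in> bdd_measurable N" using g by (simp add: resolvent_at_def)
  have nonneg: "0 \<le> g p" if "p \<in> space N" for p
    by (rule resolvent_nonneg_continuation[OF s res g that])
  define c where "c = max 1 (sup_norm N g)"
  have c: "0 < c" "\<And>p. p \<in> space N \<Longrightarrow> g p \<le> c"
    using norm_le_sup_norm[OF gm] by (force simp: c_def)+
  have Ly: "0 \<le> s - 1 / c" "\<And>p. p \<in> space N \<Longrightarrow> 1 \<le> s * g p"
    "\<And>p. p \<in> space N \<Longrightarrow> V g p \<le> (s - 1 / c) * g p"
    using resolvent_Lyapunov[OF g nonneg s c] by auto
  have "V (\<lambda>q. s * g q) p \<le> (s - 1 / c) * (s * g p)" if "p \<in> space N" for p
    using mult_left_mono[OF Ly(3)[OF that] s] V_scale[OF gm that, of s] by (simp add: mult_ac)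
  moreover have "s * g p \<le> s * c" if "p \<in> space N" for p
    by (rule mult_left_mono[OF c(2)[OF that] s])
  ultimately show thesis
    using Ly(1,2) c(1) by (intro that[OF bdd_measurable_mult_left[OF gm, of s], of "s - 1 / c" "s * c"]) auto
qed

end

section \<open>Total variation and integrals of bounded functions\<close>

lemma bdd_measurable_cong_sets: "sets N = sets N' \<Longrightarrow> bdd_measurable N = bdd_measurable N'"
  using measurable_cong_sets[of N N' borel borel] sets_eq_imp_space_eq[of N N']
  by (auto simp: bdd_measurable_def)

lemma integrable_bdd_mult:
  fixes f g :: "'a \<Rightarrow> real"
  assumes "f \<in> bdd_measurable N" "integrable N g"
  shows "integrable N (\<lambda>x. f x * g x)"
proof (rule Bochner_Integration.integrable_bound)
  show "integrable N (\<lambda>x. sup_norm N f * \<bar>g x\<bar>)"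
    using assms by (intro integrable_mult_right integrable_abs)
  show "(\<lambda>x. f x * g x) \<in> borel_measurable N"
    using assms by (intro borel_measurable_times bdd_measurable_measurable borel_measurable_integrable)
  show "AE x in N. norm (f x * g x) \<le> norm (sup_norm N f * \<bar>g x\<bar>)"
    using norm_le_sup_norm[OF assms(1)]
    by (intro AE_I2) (force simp: abs_mult intro!: mult_mono)
qed

lemma (in finite_measure) integrable_bdd:
  fixes f :: "'a \<Rightarrow> real"
  assumes "f \<in> bdd_measurable M"
  shows "integrable M f"
  using integrable_bdd_mult[OF assms integrable_const[of 1]] by simp

lemma (in prob_space) expectation_shift:
  fixes f :: "'a \<Rightarrow> real"
  assumes "integrable M f"
  shows "expectation (\<lambda>x. c - f x) = c - expectation f"
    and "expectation (\<lambda>x. f x - c) = expectation f - c"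
  using assms by (simp_all add: prob_space)

lemma
  assumes "sigma_finite_measure \<Lambda>" "prob_space \<mu>" "sets \<mu> = sets \<Lambda>" "absolutely_continuous \<Lambda> \<mu>"
  shows dens_nonneg: "0 \<le> dens \<Lambda> \<mu> u"
    and dens_measurable: "dens \<Lambda> \<mu> \<in> borel_measurable \<Lambda>"
    and dens_integrable: "integrable \<Lambda> (dens \<Lambda> \<mu>)"
    and dens_integral: "f \<in> borel_measurable \<Lambda> \<Longrightarrow> (\<integral>u. f u \<partial>\<mu>) = (\<integral>u. f u * dens \<Lambda> \<mu> u \<partial>\<Lambda>)"
    and dens_total: "(\<integral>u. dens \<Lambda> \<mu> u \<partial>\<Lambda>) = 1"
proof -
  interpret \<Lambda>: sigma_finite_measure \<Lambda> by fact
  interpret \<mu>: prob_space \<mu> by fact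
  have sf: "sigma_finite_measure \<mu>" by unfold_locales
  show "0 \<le> dens \<Lambda> \<mu> u" "dens \<Lambda> \<mu> \<in> borel_measurable \<Lambda>"
    by (auto simp: dens_def[abs_def])
  show int: "(\<integral>u. f u \<partial>\<mu>) = (\<integral>u. f u * dens \<Lambda> \<mu> u \<partial>\<Lambda>)" if "f \<in> borel_measurable \<Lambda>" for f
    using \<Lambda>.RN_deriv_integral[OF sf assms(4,3) that] by (simp add: dens_def mult.commute)
  show "integrable \<Lambda> (dens \<Lambda> \<mu>)"
    using \<Lambda>.RN_deriv_integrable[OF sf assms(4,3), of "\<lambda>_. 1"] by (simp add: dens_def[abs_def])
  show "(\<integral>u. dens \<Lambda> \<mu> u \<partial>\<Lambda>) = 1"
    using int[of "\<lambda>_. 1"] by (simp add: \<mu>.prob_space)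
qed

lemma tv_norm_diff_le:
  assumes "\<And>A. A \<in> sets \<mu> \<Longrightarrow> measure \<mu> A - measure \<nu> A \<le> c"
  shows "tv_norm_diff \<mu> \<nu> \<le> 2 * c"
  unfolding tv_norm_diff_def using assms by (auto intro!: cSUP_least)

lemma measure_diff_le_tv:
  assumes "prob_space \<mu>" "A \<in> sets \<mu>"
  shows "measure \<mu> A - measure \<nu> A \<le> tv_norm_diff \<mu> \<nu> / 2"
proof -
  interpret prob_space \<mu> by fact
  have "bdd_above ((\<lambda>A. measure \<mu> A - measure \<nu> A) ` sets \<mu>)"
    using prob_le_1 by (intro bdd_aboveI2[of _ _ 1]) (smt (verit) measure_nonneg)
  then show ?thesis
    unfolding tv_norm_diff_def using assms(2) by (auto intro: cSUP_upper)
qed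

text \<open>The witness is the infimum of \<open>f\<close> on \<open>S\<close>.\<close>

lemma oscillation_bounds:
  fixes f :: "'a \<Rightarrow> real"
  assumes "S \<noteq> {}" "\<And>x y. \<lbrakk>x \<in> S; y \<in> S\<rbrakk> \<Longrightarrow> f x - f y \<le> K"
  obtains c where "\<And>x. x \<in> S \<Longrightarrow> c \<le> f x" "\<And>x. x \<in> S \<Longrightarrow> f x \<le> c + K"
proof
  obtain x0 where x0: "x0 \<in> S" using assms(1) by blast
  have "bdd_below (f ` S)"
    using assms(2)[OF x0] by (intro bdd_belowI2[of _ "f x0 - K"]) (auto simp: algebra_simps)
  then show "(INF y\<in>S. f y) \<le> f x" if "x \<in> S" for x
    using that by (rule cINF_lower)
  show "f x \<le> (INF y\<in>S. f y) + K" if "x \<in> S" for x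
    using cINF_greatest[OF assms(1), of "f x - K" f] assms(2)[OF that] by (auto simp: algebra_simps)
qed

lemma bdd_measurable_oscillation:
  fixes f :: "'a \<Rightarrow> real"
  assumes "f \<in> borel_measurable N" "\<And>x y. \<lbrakk>x \<in> space N; y \<in> space N\<rbrakk> \<Longrightarrow> f x - f y \<le> K"
  shows "f \<in> bdd_measurable N"
proof (cases "space N = {}")
  case True
  then show ?thesis using assms(1) by (intro bdd_measurableI[of _ _ 0]) auto
next
  case False
  obtain c where "\<And>x. x \<in> space N \<Longrightarrow> c \<le> f x" "\<And>x. x \<in> space N \<Longrightarrow> f x \<le> c + K"
    using oscillation_bounds[of "space N" f K] False assms(2) by blast
  then show ?thesis
    using assms(1) by (intro bdd_measurableI[of _ _ "\<bar>c\<bar> + \<bar>K\<bar>"]) (auto simp: abs_le_iff, (smt (verit))+)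
qed

text \<open>After subtracting a constant, \<open>f\<close> takes values in the interval from 0 to
  \<open>K\<close>, so its integral against the signed measure is at most \<open>K\<close> times the
  mass of the positive part. The factor one half undoes the normalisation of
  \<open>tv_norm_diff\<close>.\<close>

lemma integral_diff_le_tv:
  fixes f :: "'a \<Rightarrow> real"
  assumes sf: "sigma_finite_measure \<Lambda>"
    and \<mu>: "prob_space \<mu>" "sets \<mu> = sets \<Lambda>" "absolutely_continuous \<Lambda> \<mu>"
    and \<nu>: "prob_space \<nu>" "sets \<nu> = sets \<Lambda>" "absolutely_continuous \<Lambda> \<nu>"
    and f: "f \<in> borel_measurable \<Lambda>" "\<And>x y. \<lbrakk>x \<in> space \<Lambda>; y \<in> space \<Lambda>\<rbrakk> \<Longrightarrow> f x - f y \<le> K"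
    and K: "0 \<le> K"
  shows "(\<integral>x. f x \<partial>\<mu>) - (\<integral>x. f x \<partial>\<nu>) \<le> K * (tv_norm_diff \<mu> \<nu> / 2)"
proof -
  interpret \<mu>: prob_space \<mu> by fact
  interpret \<nu>: prob_space \<nu> by fact
  have sp: "space \<Lambda> = space \<mu>" "space \<Lambda> = space \<nu>"
    using \<mu>(2) \<nu>(2) by (auto dest: sets_eq_imp_space_eq)
  obtain c where c: "\<And>x. x \<in> space \<Lambda> \<Longrightarrow> c \<le> f x" "\<And>x. x \<in> space \<Lambda> \<Longrightarrow> f x \<le> c + K"
    using oscillation_bounds[of "space \<Lambda>" f K] f(2) sp \<mu>.not_empty by blast
  let ?p = "dens \<Lambda> \<mu>" and ?q = "dens \<Lambda> \<nu>"
  note p = dens_measurable[OF sf \<mu>] dens_integrable[OF sf \<mu>] dens_total[OF sf \<mu>] dens_integral[OF sf \<mu>]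
  note q = dens_measurable[OF sf \<nu>] dens_integrable[OF sf \<nu>] dens_total[OF sf \<nu>] dens_integral[OF sf \<nu>]
  note [measurable] = p(1) q(1) f(1)
  \<comment> \<open>The positive set of the Hahn decomposition of the difference of the two
    measures.\<close>
  define A where "A = {x \<in> space \<Lambda>. ?q x < ?p x}"
  have A[measurable]: "A \<in> sets \<Lambda>" unfolding A_def by measurable
  have fb: "f \<in> bdd_measurable \<Lambda>" by (rule bdd_measurable_oscillation[OF f])
  have Ab: "(indicator A :: 'a \<Rightarrow> real) \<in> bdd_measurable \<Lambda>"
    by (rule bdd_measurableI[of _ _ 1]) (auto simp: indicator_def)
  note int = integrable_bdd_mult[OF fb p(2)] integrable_bdd_mult[OF fb q(2)]
    integrable_bdd_mult[OF Ab p(2)] integrable_bdd_mult[OF Ab q(2)] p(2) q(2)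
  \<comment> \<open>Subtracting \<open>c\<close> costs nothing because both densities have total
    mass 1.\<close>
  have "(\<integral>x. f x \<partial>\<mu>) - (\<integral>x. f x \<partial>\<nu>) = (\<integral>x. (f x * ?p x - f x * ?q x) - c * (?p x - ?q x) \<partial>\<Lambda>)"
    using p(3) q(3) int by (simp add: p(4) q(4))
  also have "\<dots> \<le> (\<integral>x. K * (indicator A x * ?p x - indicator A x * ?q x) \<partial>\<Lambda>)"
  proof (rule integral_mono)
    fix x assume x: "x \<in> space \<Lambda>"
    show "(f x * ?p x - f x * ?q x) - c * (?p x - ?q x)
        \<le> K * (indicator A x * ?p x - indicator A x * ?q x)"
    proof (cases "x \<in> A")
      case True
      then have "(f x - c) * (?p x - ?q x) \<le> K * (?p x - ?q x)"
        using c(2)[OF x] by (intro mult_right_mono) (auto simp: A_def)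
      with True show ?thesis by (simp add: algebra_simps)
    next
      case False
      then have "(f x - c) * (?p x - ?q x) \<le> 0"
        using c(1)[OF x] x by (intro mult_nonneg_nonpos) (auto simp: A_def)
      with False show ?thesis by (simp add: algebra_simps)
    qed
  qed (use int in auto)
  also have "\<dots> = K * ((\<integral>x. indicator A x * ?p x \<partial>\<Lambda>) - (\<integral>x. indicator A x * ?q x \<partial>\<Lambda>))"
    using int by simp
  also have "\<dots> = K * (measure \<mu> A - measure \<nu> A)"
    using p(4)[of "indicator A"] q(4)[of "indicator A"] A \<mu>(2) \<nu>(2) by simp
  also have "\<dots> \<le> K * (tv_norm_diff \<mu> \<nu> / 2)"
    using A \<mu>(2) K by (intro mult_left_mono measure_diff_le_tv \<mu>(1)) auto
  finally show ?thesis .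
qed

section \<open>The coupling operator\<close>

locale density_pair = sigma_finite_measure \<Lambda> for \<Lambda> :: "'a measure" +
  fixes \<phi>\<^sub>1 \<phi>\<^sub>2 :: "'a \<Rightarrow> real"
  assumes integrable: "integrable \<Lambda> \<phi>\<^sub>1" "integrable \<Lambda> \<phi>\<^sub>2"
    and nonneg: "\<And>u. u \<in> space \<Lambda> \<Longrightarrow> 0 \<le> \<phi>\<^sub>1 u" "\<And>u. u \<in> space \<Lambda> \<Longrightarrow> 0 \<le> \<phi>\<^sub>2 u"
    and total: "(\<integral>u. \<phi>\<^sub>1 u \<partial>\<Lambda>) = 1" "(\<integral>u. \<phi>\<^sub>2 u \<partial>\<Lambda>) = 1"
begin

text \<open>The expectation of \<open>h\<close> under the independent coupling of the two densities,
  as an iterated integral in the same form as in \<open>V_op\<close>.\<close>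

definition avg :: "('a \<times> 'a \<Rightarrow> real) \<Rightarrow> real" where
  "avg h = (\<integral>u2. (\<integral>u1. h (u1, u2) * \<phi>\<^sub>1 u1 * \<phi>\<^sub>2 u2 \<partial>\<Lambda>) \<partial>\<Lambda>)"

lemma section_bdd:
  assumes "h \<in> bdd_measurable (\<Lambda> \<Otimes>\<^sub>M \<Lambda>)" "u2 \<in> space \<Lambda>"
  shows "(\<lambda>u1. h (u1, u2)) \<in> bdd_measurable \<Lambda>"
proof (rule bdd_measurableI)
  show "(\<lambda>u1. h (u1, u2)) \<in> borel_measurable \<Lambda>"
    using assms by (intro measurable_compose[OF measurable_Pair2' bdd_measurable_measurable])
  show "norm (h (u1, u2)) \<le> sup_norm (\<Lambda> \<Otimes>\<^sub>M \<Lambda>) h" if "u1 \<in> space \<Lambda>" for u1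
    using assms that by (intro norm_le_sup_norm) (auto simp: space_pair_measure)
qed

lemma inner_integrable:
  assumes "h \<in> bdd_measurable (\<Lambda> \<Otimes>\<^sub>M \<Lambda>)" "u2 \<in> space \<Lambda>"
  shows "integrable \<Lambda> (\<lambda>u1. h (u1, u2) * \<phi>\<^sub>1 u1 * \<phi>\<^sub>2 u2)"
  by (intro integrable_mult_left integrable_bdd_mult section_bdd assms integrable)

lemma inner_mono:
  assumes "h \<in> bdd_measurable (\<Lambda> \<Otimes>\<^sub>M \<Lambda>)" "g \<in> bdd_measurable (\<Lambda> \<Otimes>\<^sub>M \<Lambda>)" "u2 \<in> space \<Lambda>"
    and "\<And>p. p \<in> space (\<Lambda> \<Otimes>\<^sub>M \<Lambda>) \<Longrightarrow> h p \<le> g p"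
  shows "(\<integral>u1. h (u1, u2) * \<phi>\<^sub>1 u1 * \<phi>\<^sub>2 u2 \<partial>\<Lambda>) \<le> (\<integral>u1. g (u1, u2) * \<phi>\<^sub>1 u1 * \<phi>\<^sub>2 u2 \<partial>\<Lambda>)"
  using assms
  by (intro integral_mono inner_integrable mult_right_mono nonneg) (auto simp: space_pair_measure)

lemma inner_const: "(\<integral>u1. c * \<phi>\<^sub>1 u1 * \<phi>\<^sub>2 u2 \<partial>\<Lambda>) = c * \<phi>\<^sub>2 u2"
  using total by simp

lemma outer_integrable:
  assumes h: "h \<in> bdd_measurable (\<Lambda> \<Otimes>\<^sub>M \<Lambda>)"
  shows "integrable \<Lambda> (\<lambda>u2. \<integral>u1. h (u1, u2) * \<phi>\<^sub>1 u1 * \<phi>\<^sub>2 u2 \<partial>\<Lambda>)"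
proof (rule Bochner_Integration.integrable_bound)
  let ?c = "sup_norm (\<Lambda> \<Otimes>\<^sub>M \<Lambda>) h"
  show "integrable \<Lambda> (\<lambda>u2. ?c * \<phi>\<^sub>2 u2)"
    using integrable by simp
  have [measurable]: "h \<in> borel_measurable (\<Lambda> \<Otimes>\<^sub>M \<Lambda>)" "\<phi>\<^sub>1 \<in> borel_measurable \<Lambda>" "\<phi>\<^sub>2 \<in> borel_measurable \<Lambda>"
    using integrable h by (auto dest: bdd_measurable_measurable)
  show "(\<lambda>u2. \<integral>u1. h (u1, u2) * \<phi>\<^sub>1 u1 * \<phi>\<^sub>2 u2 \<partial>\<Lambda>) \<in> borel_measurable \<Lambda>"
    by measurable
  \<comment> \<open>\<open>h\<close> is squeezed between two constants, for which the inner integral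
    is explicit.\<close>
  have "\<bar>\<integral>u1. h (u1, u2) * \<phi>\<^sub>1 u1 * \<phi>\<^sub>2 u2 \<partial>\<Lambda>\<bar> \<le> ?c * \<phi>\<^sub>2 u2" if u2: "u2 \<in> space \<Lambda>" for u2
    using inner_mono[OF h bdd_measurable_const[of ?c] u2] inner_mono[OF bdd_measurable_const[of "- ?c"] h u2]
      norm_le_sup_norm[OF h] inner_const[of ?c u2] inner_const[of "- ?c" u2]
    by (force simp: abs_le_iff)
  then show "AE u2 in \<Lambda>. norm (\<integral>u1. h (u1, u2) * \<phi>\<^sub>1 u1 * \<phi>\<^sub>2 u2 \<partial>\<Lambda>) \<le> norm (?c * \<phi>\<^sub>2 u2)"
    by (intro AE_I2) force
qed

lemma avg_add:
  assumes "h \<in> bdd_measurable (\<Lambda> \<Otimes>\<^sub>M \<Lambda>)" "g \<in> bdd_measurable (\<Lambda> \<Otimes>\<^sub>M \<Lambda>)"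
  shows "avg (\<lambda>p. h p + g p) = avg h + avg g"
proof -
  have "avg (\<lambda>p. h p + g p) = (\<integral>u2. (\<integral>u1. h (u1, u2) * \<phi>\<^sub>1 u1 * \<phi>\<^sub>2 u2 \<partial>\<Lambda>)
      + (\<integral>u1. g (u1, u2) * \<phi>\<^sub>1 u1 * \<phi>\<^sub>2 u2 \<partial>\<Lambda>) \<partial>\<Lambda>)"
    unfolding avg_def
    by (intro Bochner_Integration.integral_cong refl)
      (simp add: distrib_right Bochner_Integration.integral_add[OF inner_integrable[OF assms(1)] inner_integrable[OF assms(2)]])
  also have "\<dots> = avg h + avg g"
    unfolding avg_def by (intro Bochner_Integration.integral_add outer_integrable assms)
  finally show ?thesis .
qed

lemma avg_scale: "avg (\<lambda>p. c * h p) = c * avg h"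
  unfolding avg_def by (simp add: mult.assoc)

lemma avg_mono:
  assumes "h \<in> bdd_measurable (\<Lambda> \<Otimes>\<^sub>M \<Lambda>)" "g \<in> bdd_measurable (\<Lambda> \<Otimes>\<^sub>M \<Lambda>)"
    and "\<And>p. p \<in> space (\<Lambda> \<Otimes>\<^sub>M \<Lambda>) \<Longrightarrow> h p \<le> g p"
  shows "avg h \<le> avg g"
  unfolding avg_def using assms by (intro integral_mono outer_integrable inner_mono)

lemma avg_const: "avg (\<lambda>_. c) = c"
  unfolding avg_def inner_const using total by simp

text \<open>A difference of one-variable functions sees only the two marginals of the
  coupling.\<close>

lemma avg_difference:
  assumes f: "f \<in> bdd_measurable \<Lambda>"
  shows "avg (\<lambda>(u1, u2). f u1 - f u2) = (\<integral>u. f u * \<phi>\<^sub>1 u \<partial>\<Lambda>) - (\<integral>u. f u * \<phi>\<^sub>2 u \<partial>\<Lambda>)"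
proof -
  note int = integrable integrable_bdd_mult[OF f integrable(1)] integrable_bdd_mult[OF f integrable(2)]
  let ?a = "\<integral>u. f u * \<phi>\<^sub>1 u \<partial>\<Lambda>"
  have "(\<integral>u1. (f u1 - f u2) * \<phi>\<^sub>1 u1 * \<phi>\<^sub>2 u2 \<partial>\<Lambda>) = ?a * \<phi>\<^sub>2 u2 - f u2 * \<phi>\<^sub>2 u2" for u2
    using int total by (simp add: left_diff_distrib)
  then show ?thesis
    unfolding avg_def using int total by simp
qed

end

lemma bdd_measurable_difference:
  fixes f :: "'a \<Rightarrow> real"
  assumes "f \<in> bdd_measurable M"
  shows "(\<lambda>(u1, u2). f u1 - f u2) \<in> bdd_measurable (M \<Otimes>\<^sub>M M)"
proof (rule bdd_measurableI[of _ _ "sup_norm M f + sup_norm M f"])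
  have [measurable]: "f \<in> borel_measurable M"
    using assms by (rule bdd_measurable_measurable)
  show "(\<lambda>(u1, u2). f u1 - f u2) \<in> borel_measurable (M \<Otimes>\<^sub>M M)"
    by measurable
  show "norm ((\<lambda>(u1, u2). f u1 - f u2) p) \<le> sup_norm M f + sup_norm M f" if "p \<in> space (M \<Otimes>\<^sub>M M)" for p
    using that norm_le_sup_norm[OF assms, of "fst p"] norm_le_sup_norm[OF assms, of "snd p"]
    by (auto simp: space_pair_measure)
qed

locale dominated_kernel =
  fixes M :: "'a measure" and Q :: "'a \<Rightarrow> 'a measure" and L :: "'a \<Rightarrow> 'a \<Rightarrow> 'a measure"
  assumes Q: "Q \<in> M \<rightarrow>\<^sub>M prob_algebra M" and dom: "dominating M Q L"
begin

lemma Q_prob: "x \<in> space M \<Longrightarrow> prob_space (Q x)" "x \<in> space M \<Longrightarrow> sets (Q x) = sets M"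
  using measurable_space[OF Q] by (auto simp: space_prob_algebra)

section \<open>The coupling operator at a fixed pair of points\<close>

context
  fixes x1 x2 assumes x: "x1 \<in> space M" "x2 \<in> space M"
begin

lemma L: "sigma_finite_measure (L x1 x2)" "sets (L x1 x2) = sets M"
  "absolutely_continuous (L x1 x2) (Q x1)" "absolutely_continuous (L x1 x2) (Q x2)"
  using dom x by (auto simp: dominating_def)

abbreviation "p1 \<equiv> dens (L x1 x2) (Q x1)"
abbreviation "p2 \<equiv> dens (L x1 x2) (Q x2)"

lemma sets_Q: "sets (Q x1) = sets (L x1 x2)" "sets (Q x2) = sets (L x1 x2)"
  using Q_prob x L by auto

lemmas p1 = dens_nonneg[OF L(1) Q_prob(1)[OF x(1)] sets_Q(1) L(3)]
  dens_integrable[OF L(1) Q_prob(1)[OF x(1)] sets_Q(1) L(3)]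
  dens_total[OF L(1) Q_prob(1)[OF x(1)] sets_Q(1) L(3)]
  dens_integral[OF L(1) Q_prob(1)[OF x(1)] sets_Q(1) L(3)]
lemmas p2 = dens_nonneg[OF L(1) Q_prob(1)[OF x(2)] sets_Q(2) L(4)]
  dens_integrable[OF L(1) Q_prob(1)[OF x(2)] sets_Q(2) L(4)]
  dens_total[OF L(1) Q_prob(1)[OF x(2)] sets_Q(2) L(4)]
  dens_integral[OF L(1) Q_prob(1)[OF x(2)] sets_Q(2) L(4)]

lemma min_integrable: "integrable (L x1 x2) (\<lambda>u. min (p1 u) (p2 u))"
  by (intro integrable_min p1 p2)

text \<open>Both densities have mass 1 and share the same overlap, so both excesses have the same
  mass; this is what normalises \<open>phi\<close>.\<close>

lemma excess_integral:
  "(\<integral>u. p1 u - min (p1 u) (p2 u) \<partial>L x1 x2) = 1 - kappa L Q x1 x2"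
  "(\<integral>u. p2 u - min (p1 u) (p2 u) \<partial>L x1 x2) = 1 - kappa L Q x1 x2"
  using p1(2,3) p2(2,3) min_integrable by (auto simp: kappa_def)

lemma kappa_bounds: "0 \<le> kappa L Q x1 x2" "kappa L Q x1 x2 \<le> 1"
proof -
  show "0 \<le> kappa L Q x1 x2"
    unfolding kappa_def using p1(1) p2(1) by (intro integral_nonneg_AE AE_I2) simp
  have "0 \<le> (\<integral>u. p1 u - min (p1 u) (p2 u) \<partial>L x1 x2)"
    by (intro integral_nonneg_AE AE_I2) simp
  then show "kappa L Q x1 x2 \<le> 1"
    using excess_integral by simp
qed

lemma density_pair:
  assumes "kappa L Q x1 x2 \<noteq> 1"
  shows "density_pair (L x1 x2) (phi L Q x1 x2 x1) (phi L Q x1 x2 x2)"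
proof -
  interpret sigma_finite_measure "L x1 x2" by (rule L)
  show ?thesis
  proof
    show "integrable (L x1 x2) (phi L Q x1 x2 x1)" "integrable (L x1 x2) (phi L Q x1 x2 x2)"
      using p1(2) p2(2) min_integrable by (auto simp: phi_def[abs_def])
    show "0 \<le> phi L Q x1 x2 x1 u" "0 \<le> phi L Q x1 x2 x2 u" for u
      using kappa_bounds by (auto simp: phi_def)
    show "(\<integral>u. phi L Q x1 x2 x1 u \<partial>L x1 x2) = 1" "(\<integral>u. phi L Q x1 x2 x2 u \<partial>L x1 x2) = 1"
      using excess_integral assms by (simp_all add: phi_def)
  qed
qed

lemma V_op_eq_avg:
  "kappa L Q x1 x2 \<noteq> 1 \<Longrightarrow> V_op L Q h (x1, x2) =
    (1 - kappa L Q x1 x2) * density_pair.avg (L x1 x2) (phi L Q x1 x2 x1) (phi L Q x1 x2 x2) h"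
  using density_pair.avg_def[OF density_pair] by (simp add: V_op_def)

lemma bdd_pair: "bdd_measurable (M \<Otimes>\<^sub>M M) = bdd_measurable (L x1 x2 \<Otimes>\<^sub>M L x1 x2)"
  "space (M \<Otimes>\<^sub>M M) = space (L x1 x2 \<Otimes>\<^sub>M L x1 x2)"
  "bdd_measurable M = bdd_measurable (L x1 x2)"
  using L(2) by (auto intro!: bdd_measurable_cong_sets sets_pair_measure_cong sets_eq_imp_space_eq)

text \<open>The overlap of the two densities cancels in the difference, and the remaining excesses
  are \<open>1 - kappa\<close> times the densities \<open>phi\<close>. This is the link between the
  linear kernel and \<open>V\<close>.\<close>

lemma integral_difference:
  fixes f :: "'a \<Rightarrow> real"
  assumes f: "f \<in> bdd_measurable M"
  shows "(\<integral>u. f u \<partial>Q x1) - (\<integral>u. f u \<partial>Q x2) = V_op L Q (\<lambda>(u1, u2). f u1 - f u2) (x1, x2)"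
proof -
  let ?a1 = "\<lambda>u. p1 u - min (p1 u) (p2 u)" and ?a2 = "\<lambda>u. p2 u - min (p1 u) (p2 u)"
  have fL: "f \<in> bdd_measurable (L x1 x2)" using f by (simp add: bdd_pair)
  note int = integrable_bdd_mult[OF fL]
  have diff: "(\<integral>u. f u \<partial>Q x1) - (\<integral>u. f u \<partial>Q x2)
      = (\<integral>u. f u * ?a1 u \<partial>L x1 x2) - (\<integral>u. f u * ?a2 u \<partial>L x1 x2)"
    using bdd_measurable_measurable[OF fL] int[OF p1(2)] int[OF p2(2)] int[OF min_integrable]
    by (simp add: p1(4) p2(4) right_diff_distrib)
  show ?thesis
  proof (cases "kappa L Q x1 x2 = 1")
    case True
    have "integrable (L x1 x2) ?a1" "integrable (L x1 x2) ?a2"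
      using p1(2) p2(2) min_integrable by auto
    \<comment> \<open>Nonnegative excesses of mass zero vanish almost everywhere, in agreement with
      the value 0 that \<open>V_op\<close> takes in this case.\<close>
    then have "AE u in L x1 x2. ?a1 u = 0" "AE u in L x1 x2. ?a2 u = 0"
      using excess_integral True
      by (subst integral_nonneg_eq_0_iff_AE[symmetric]; simp)+
    then have "(\<integral>u. f u * ?a1 u \<partial>L x1 x2) = 0" "(\<integral>u. f u * ?a2 u \<partial>L x1 x2) = 0"
      by (auto intro!: integral_eq_zero_AE)
    then show ?thesis
      using diff True by (simp add: V_op_def)
  next
    case False
    interpret density_pair "L x1 x2" "phi L Q x1 x2 x1" "phi L Q x1 x2 x2"
      by (rule density_pair[OF False])
    have "f u * ?a1 u = (1 - kappa L Q x1 x2) * (f u * phi L Q x1 x2 x1 u)"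
      "f u * ?a2 u = (1 - kappa L Q x1 x2) * (f u * phi L Q x1 x2 x2 u)" for u
      using False by (simp_all add: phi_def)
    then show ?thesis
      unfolding diff V_op_eq_avg[OF False] avg_difference[OF fL] by (simp add: right_diff_distrib)
  qed
qed

lemma V_op_add:
  assumes "h \<in> bdd_measurable (M \<Otimes>\<^sub>M M)" "g \<in> bdd_measurable (M \<Otimes>\<^sub>M M)"
  shows "V_op L Q (\<lambda>p. h p + g p) (x1, x2) = V_op L Q h (x1, x2) + V_op L Q g (x1, x2)"
proof (cases "kappa L Q x1 x2 = 1")
  case False
  then show ?thesis
    using density_pair.avg_add[OF density_pair[OF False]] assms
    by (simp add: V_op_eq_avg bdd_pair distrib_left)
qed (simp add: V_op_def)

lemma V_op_scale: "V_op L Q (\<lambda>p. c * h p) (x1, x2) = c * V_op L Q h (x1, x2)"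
proof (cases "kappa L Q x1 x2 = 1")
  case False
  then show ?thesis
    using density_pair.avg_scale[OF density_pair[OF False]] by (simp add: V_op_eq_avg)
qed (simp add: V_op_def)

lemma V_op_mono:
  assumes "h \<in> bdd_measurable (M \<Otimes>\<^sub>M M)" "g \<in> bdd_measurable (M \<Otimes>\<^sub>M M)"
    and "\<And>p. p \<in> space (M \<Otimes>\<^sub>M M) \<Longrightarrow> h p \<le> g p"
  shows "V_op L Q h (x1, x2) \<le> V_op L Q g (x1, x2)"
proof (cases "kappa L Q x1 x2 = 1")
  case False
  then show ?thesis
    using density_pair.avg_mono[OF density_pair[OF False]] assms kappa_bounds
    by (simp add: V_op_eq_avg bdd_pair mult_left_mono)
qed (simp add: V_op_def)

lemma V_op_const_abs_le: "\<bar>V_op L Q (\<lambda>_. c) (x1, x2)\<bar> \<le> \<bar>c\<bar>"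
proof (cases "kappa L Q x1 x2 = 1")
  case False
  have "(1 - kappa L Q x1 x2) * \<bar>c\<bar> \<le> 1 * \<bar>c\<bar>"
    using kappa_bounds by (intro mult_right_mono) auto
  then show ?thesis
    using density_pair.avg_const[OF density_pair[OF False]] False kappa_bounds
    by (simp add: V_op_eq_avg abs_mult)
qed (simp add: V_op_def)

end

lemma positive_operator_V_op:
  assumes ne: "space M \<noteq> {}"
    and meas: "\<And>h. h \<in> bdd_measurable (M \<Otimes>\<^sub>M M) \<Longrightarrow> V_op L Q h \<in> borel_measurable (M \<Otimes>\<^sub>M M)"
  shows "positive_operator (M \<Otimes>\<^sub>M M) (V_op L Q)"
proof
  show "space (M \<Otimes>\<^sub>M M) \<noteq> {}"
    using ne by (auto simp: space_pair_measure)
  fix h :: "'a \<times> 'a \<Rightarrow> real" assume h: "h \<in> bdd_measurable (M \<Otimes>\<^sub>M M)"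
  show "V_op L Q h \<in> bdd_measurable (M \<Otimes>\<^sub>M M)"
  proof (rule bdd_measurableI[OF meas[OF h]])
    fix p assume "p \<in> space (M \<Otimes>\<^sub>M M)"
    then obtain x y where p: "p = (x, y)" "x \<in> space M" "y \<in> space M"
      by (auto simp: space_pair_measure)
    let ?c = "sup_norm (M \<Otimes>\<^sub>M M) h"
    have "V_op L Q h p \<le> V_op L Q (\<lambda>_. ?c) p" "V_op L Q (\<lambda>_. - ?c) p \<le> V_op L Q h p"
      unfolding p(1) using norm_le_sup_norm[OF h]
      by (intro V_op_mono p h bdd_measurable_const; force simp: abs_le_iff)+
    then show "norm (V_op L Q h p) \<le> \<bar>?c\<bar>"
      using V_op_const_abs_le[OF p(2,3), of ?c] V_op_const_abs_le[OF p(2,3), of "- ?c"] p(1)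
      by auto
  qed
  fix p assume "p \<in> space (M \<Otimes>\<^sub>M M)"
  then obtain x y where p: "p = (x, y)" "x \<in> space M" "y \<in> space M"
    by (auto simp: space_pair_measure)
  show "V_op L Q (\<lambda>q. h q + g q) p = V_op L Q h p + V_op L Q g p" if "g \<in> bdd_measurable (M \<Otimes>\<^sub>M M)" for g
    unfolding p(1) by (rule V_op_add[OF p(2,3) h that])
  show "V_op L Q (\<lambda>q. c * h q) p = c * V_op L Q h p" for c
    unfolding p(1) by (rule V_op_scale[OF p(2,3)])
  show "0 \<le> V_op L Q h p" if "\<And>q. q \<in> space (M \<Otimes>\<^sub>M M) \<Longrightarrow> 0 \<le> h q"
    using V_op_mono[OF p(2,3) bdd_measurable_const[of 0] h that] V_op_scale[OF p(2,3), of 0 "\<lambda>_. 0"]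
    by (simp add: p(1))
qed

end

section \<open>Contraction for the nonlinear chain\<close>

text \<open>Functions whose difference is dominated by \<open>w\<close> replace couplings with cost \<open>w\<close>, by duality.\<close>

definition dominated_functions :: "'a measure \<Rightarrow> ('a \<times> 'a \<Rightarrow> real) \<Rightarrow> ('a \<Rightarrow> real) set" where
  "dominated_functions M w =
    {f \<in> borel_measurable M. \<forall>x\<in>space M. \<forall>y\<in>space M. f x - f y \<le> w (x, y)}"

lemma close_kernels_integral_le:
  assumes Q: "prob_space \<pi>" "sets \<pi> = sets \<sigma>" and P: "prob_space \<sigma>"
    and ac: "absolutely_continuous \<sigma> \<pi>"
    and bound: "AE y in \<sigma>. RN_deriv \<sigma> \<pi> y \<le> ennreal (1 + \<gamma>)" and \<gamma>: "0 \<le> \<gamma>"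
    and f: "f \<in> bdd_measurable \<sigma>" "\<And>x. x \<in> space \<sigma> \<Longrightarrow> 0 \<le> f x"
  shows "(\<integral>x. f x \<partial>\<pi>) \<le> (1 + \<gamma>) * (\<integral>x. f x \<partial>\<sigma>)"
proof -
  interpret \<sigma>: prob_space \<sigma> by fact
  have sf: "sigma_finite_measure \<sigma>" by unfold_locales
  have "(\<integral>x. f x \<partial>\<pi>) = (\<integral>x. f x * dens \<sigma> \<pi> x \<partial>\<sigma>)"
    by (rule dens_integral[OF sf Q ac bdd_measurable_measurable[OF f(1)]])
  also have "\<dots> \<le> (\<integral>x. f x * (1 + \<gamma>) \<partial>\<sigma>)"
  proof (rule integral_mono_AE)
    show "integrable \<sigma> (\<lambda>x. f x * dens \<sigma> \<pi> x)"
      by (intro integrable_bdd_mult f dens_integrable[OF sf Q ac])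
    show "integrable \<sigma> (\<lambda>x. f x * (1 + \<gamma>))"
      by (intro integrable_bdd_mult f) simp
    show "AE x in \<sigma>. f x * dens \<sigma> \<pi> x \<le> f x * (1 + \<gamma>)"
      using bound AE_space
    proof eventually_elim
      case (elim x)
      then have "dens \<sigma> \<pi> x \<le> 1 + \<gamma>"
        using \<gamma> unfolding dens_def by (intro enn2real_leI) auto
      then show ?case using f(2) elim by (intro mult_left_mono) auto
    qed
  qed
  finally show ?thesis by (simp add: mult.commute)
qed

text \<open>Fixes a Lyapunov function \<open>w\<close> for \<open>V\<close> with rate
  \<open>\<theta>\<close>, together with a family \<open>P\<close> close to \<open>Q\<close>;
  \<open>\<beta>\<close> is its one-step Lipschitz constant.\<close>

locale perturbed_chain = dominated_kernel M Q L
  for M :: "'a measure" and Q :: "'a \<Rightarrow> 'a measure" and L :: "'a \<Rightarrow> 'a \<Rightarrow> 'a measure" +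
  fixes w :: "'a \<times> 'a \<Rightarrow> real" and \<theta> K \<gamma> \<beta> :: real
    and P :: "'a measure \<Rightarrow> 'a \<Rightarrow> 'a measure"
  assumes w: "w \<in> bdd_measurable (M \<Otimes>\<^sub>M M)"
    and w_ge: "\<And>p. p \<in> space (M \<Otimes>\<^sub>M M) \<Longrightarrow> 1 \<le> w p"
    and w_le: "\<And>p. p \<in> space (M \<Otimes>\<^sub>M M) \<Longrightarrow> w p \<le> K"
    and V_w: "\<And>p. p \<in> space (M \<Otimes>\<^sub>M M) \<Longrightarrow> V_op L Q w p \<le> \<theta> * w p"
    and const: "1 \<le> K" "0 \<le> \<theta>" "0 < \<gamma>" "0 \<le> \<beta>"
    and P: "\<And>\<mu>. \<mu> \<in> space (prob_algebra M) \<Longrightarrow> P \<mu> \<in> M \<rightarrow>\<^sub>M prob_algebra M"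
    and close: "close_kernels M Q P \<gamma>"
    and lip: "tv_lipschitz M P 1 \<beta>"
begin

abbreviation F :: "('a \<Rightarrow> real) set" where "F \<equiv> dominated_functions M w"

lemma F_oscillation:
  assumes "f \<in> F" "x \<in> space M" "y \<in> space M"
  shows "f x - f y \<le> K"
proof -
  have "f x - f y \<le> w (x, y)"
    using assms by (simp add: dominated_functions_def)
  also have "\<dots> \<le> K"
    using assms(2,3) by (intro w_le) (simp add: space_pair_measure)
  finally show ?thesis .
qed

lemma F_bdd: "f \<in> F \<Longrightarrow> f \<in> bdd_measurable M"
  using bdd_measurable_oscillation[of f M K] F_oscillation by (auto simp: dominated_functions_def)

text \<open>The difference of the integrals is \<open>V\<close> applied to \<open>f u - f v\<close>,
  which lies below \<open>w\<close>; positivity and the Lyapunov inequality finish.\<close>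

lemma Q_contraction:
  assumes f: "f \<in> F" and x: "x \<in> space M" "y \<in> space M"
  shows "(\<integral>u. f u \<partial>Q x) - (\<integral>u. f u \<partial>Q y) \<le> \<theta> * w (x, y)"
proof -
  have "(\<integral>u. f u \<partial>Q x) - (\<integral>u. f u \<partial>Q y) \<le> V_op L Q w (x, y)"
    unfolding integral_difference[OF x F_bdd[OF f]]
    using f by (intro V_op_mono x bdd_measurable_difference F_bdd w)
      (auto simp: dominated_functions_def space_pair_measure)
  also have "\<dots> \<le> \<theta> * w (x, y)"
    using x by (intro V_w) (simp add: space_pair_measure)
  finally show ?thesis .
qed

section \<open>Integration against the kernel of a fixed law\<close>

context
  fixes \<mu> assumes \<mu>: "\<mu> \<in> space (prob_algebra M)"
begin

lemma P_prob: "x \<in> space M \<Longrightarrow> prob_space (P \<mu> x)" "x \<in> space M \<Longrightarrow> sets (P \<mu> x) = sets M"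
  using measurable_space[OF P[OF \<mu>]] by (auto simp: space_prob_algebra)

lemma P_lower:
  fixes f :: "'a \<Rightarrow> real"
  assumes x: "x \<in> space M" and f: "f \<in> bdd_measurable M" "\<And>u. u \<in> space M \<Longrightarrow> 0 \<le> f u"
  shows "(\<integral>u. f u \<partial>Q x) \<le> (1 + \<gamma>) * (\<integral>u. f u \<partial>P \<mu> x)"
proof (rule close_kernels_integral_le)
  show "prob_space (Q x)" "sets (Q x) = sets (P \<mu> x)" "prob_space (P \<mu> x)"
    using x Q_prob P_prob by auto
  show "absolutely_continuous (P \<mu> x) (Q x)" "AE y in P \<mu> x. RN_deriv (P \<mu> x) (Q x) y \<le> ennreal (1 + \<gamma>)"
    using close x \<mu> by (auto simp: close_kernels_def)
  show "f \<in> bdd_measurable (P \<mu> x)"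
    using f(1) by (simp add: bdd_measurable_cong_sets[OF P_prob(2)[OF x]])
  show "0 \<le> f u" if "u \<in> space (P \<mu> x)" for u
    using that f(2) sets_eq_imp_space_eq[OF P_prob(2)[OF x]] by simp
qed (use const in simp)

text \<open>\<open>P_lower\<close> compares \<open>Q\<close> with \<open>P \<mu>\<close> for
  nonnegative functions only, so it is applied to \<open>c + K - f\<close> at \<open>x\<close> and
  to \<open>f - c\<close> at \<open>y\<close>. In the sum \<open>c\<close> cancels and the error is
  \<open>K * \<gamma>\<close>.\<close>

lemma P_contraction:
  assumes f: "f \<in> F" and x: "x \<in> space M" "y \<in> space M"
  shows "(\<integral>u. f u \<partial>P \<mu> x) - (\<integral>u. f u \<partial>P \<mu> y) \<le> (\<theta> + K * \<gamma>) * w (x, y)"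
proof -
  obtain c where c: "\<And>u. u \<in> space M \<Longrightarrow> c \<le> f u" "\<And>u. u \<in> space M \<Longrightarrow> f u \<le> c + K"
    using oscillation_bounds[of "space M" f K] F_oscillation[OF f] x by blast
  have int: "integrable (P \<mu> z) f" "integrable (Q z) f" if "z \<in> space M" for z
    using finite_measure.integrable_bdd[of "P \<mu> z" f] finite_measure.integrable_bdd[of "Q z" f]
      P_prob(1)[OF that] Q_prob(1)[OF that] F_bdd[OF f]
    by (simp_all add: prob_space_def bdd_measurable_cong_sets[OF P_prob(2)[OF that]]
        bdd_measurable_cong_sets[OF Q_prob(2)[OF that]])
  have "(\<integral>u. (c + K) - f u \<partial>Q x) \<le> (1 + \<gamma>) * (\<integral>u. (c + K) - f u \<partial>P \<mu> x)"
    using c(2) by (intro P_lower x bdd_measurable_diff bdd_measurable_const F_bdd f) (simp add: algebra_simps)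
  then have 1: "(c + K) - (\<integral>u. f u \<partial>Q x) \<le> (1 + \<gamma>) * ((c + K) - (\<integral>u. f u \<partial>P \<mu> x))"
    using int[OF x(1)] by (simp add: prob_space.expectation_shift P_prob Q_prob x)
  have "(\<integral>u. f u - c \<partial>Q y) \<le> (1 + \<gamma>) * (\<integral>u. f u - c \<partial>P \<mu> y)"
    using c(1) by (intro P_lower x bdd_measurable_diff bdd_measurable_const F_bdd f) simp
  then have 2: "(\<integral>u. f u \<partial>Q y) - c \<le> (1 + \<gamma>) * ((\<integral>u. f u \<partial>P \<mu> y) - c)"
    using int[OF x(2)] by (simp add: prob_space.expectation_shift P_prob Q_prob x)
  have "(1 + \<gamma>) * ((\<integral>u. f u \<partial>P \<mu> x) - (\<integral>u. f u \<partial>P \<mu> y))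
      \<le> ((\<integral>u. f u \<partial>Q x) - (\<integral>u. f u \<partial>Q y)) + K * \<gamma>"
    using 1 2 by (simp add: algebra_simps)
  also have "\<dots> \<le> \<theta> * w (x, y) + K * \<gamma>"
    using Q_contraction[OF f x] by simp
  \<comment> \<open>The additive error is absorbed because \<open>w\<close> is at least 1.\<close>
  also have "\<dots> \<le> (\<theta> + K * \<gamma>) * w (x, y)"
    using w_ge[of "(x, y)"] x const by (simp add: space_pair_measure distrib_right)
  finally have *: "(1 + \<gamma>) * ((\<integral>u. f u \<partial>P \<mu> x) - (\<integral>u. f u \<partial>P \<mu> y)) \<le> (\<theta> + K * \<gamma>) * w (x, y)" .
  have "0 \<le> (\<theta> + K * \<gamma>) * w (x, y)"
    using w_ge[of "(x, y)"] x const by (auto simp: space_pair_measure)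
  \<comment> \<open>Inserting the factor \<open>1 + \<gamma>\<close> on the nonnegative right-hand
    side lets it be cancelled on both sides.\<close>
  then have "(\<theta> + K * \<gamma>) * w (x, y) \<le> (1 + \<gamma>) * ((\<theta> + K * \<gamma>) * w (x, y))"
    using const by (intro mult_right_mono[of 1 "1 + \<gamma>", simplified]) auto
  with * show ?thesis
    using const by (smt (verit) mult_le_cancel_left)
qed

lemma integral_law_step:
  fixes f :: "'a \<Rightarrow> real"
  assumes "\<nu> \<in> space (prob_algebra M)" "f \<in> bdd_measurable M"
  shows "(\<integral>x. f x \<partial>(\<nu> \<bind> P \<mu>)) = (\<integral>x. (\<integral>u. f u \<partial>P \<mu> x) \<partial>\<nu>)"
proof -
  have sets: "sets \<nu> = sets M" and prob: "prob_space \<nu>"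
    using assms(1) by (auto simp: space_prob_algebra)
  interpret prob_space \<nu> by fact
  have "P \<mu> \<in> \<nu> \<rightarrow>\<^sub>M subprob_algebra M"
    using measurable_prob_algebraD[OF P[OF \<mu>]] measurable_cong_sets[OF sets refl] by blast
  then show ?thesis
    using norm_le_sup_norm[OF assms(2)] bdd_measurable_measurable[OF assms(2)] P_prob
      sets_eq_imp_space_eq[OF sets]
    by (intro integral_bind[where K = M and B = "sup_norm M f" and B' = 1])
      (auto simp: prob_space.emeasure_space_1)
qed

lemma P_measurable:
  fixes f :: "'a \<Rightarrow> real"
  assumes "f \<in> bdd_measurable M"
  shows "(\<lambda>x. \<integral>u. f u \<partial>P \<mu> x) \<in> bdd_measurable M"
proof (rule bdd_measurableI)
  show "(\<lambda>x. \<integral>u. f u \<partial>P \<mu> x) \<in> borel_measurable M"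
    by (rule measurable_compose[OF measurable_prob_algebraD[OF P[OF \<mu>]]
          integral_measurable_subprob_algebra[OF bdd_measurable_measurable[OF assms]]])
  fix x assume x: "x \<in> space M"
  interpret prob_space "P \<mu> x" by (rule P_prob[OF x])
  have "f \<in> bdd_measurable (P \<mu> x)"
    using assms by (simp add: bdd_measurable_cong_sets[OF P_prob(2)[OF x]])
  then have int: "integrable (P \<mu> x) f"
    by (rule integrable_bdd)
  have f_le: "\<bar>f u\<bar> \<le> sup_norm M f" if "u \<in> space (P \<mu> x)" for u
    using norm_le_sup_norm[OF assms, of u] that sets_eq_imp_space_eq[OF P_prob(2)[OF x]] by simp
  have "(\<integral>u. f u \<partial>P \<mu> x) \<le> sup_norm M f" "- sup_norm M f \<le> (\<integral>u. f u \<partial>P \<mu> x)"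
    using f_le by (intro integral_le_const integral_ge_const int AE_I2; force simp: abs_le_iff)+
  then show "norm (\<integral>u. f u \<partial>P \<mu> x) \<le> sup_norm M f"
    by (simp add: abs_le_iff)
qed

lemma law_mem: "law P \<mu> n \<in> space (prob_algebra M)"
proof (induction n)
  case (Suc n)
  \<comment> \<open>Read as a function on a one-point space, the law falls under the measurability
    rule for \<open>\<bind>\<close>.\<close>
  have "(\<lambda>_. law P \<mu> n \<bind> P (law P \<mu> n)) \<in> count_space {()} \<rightarrow>\<^sub>M prob_algebra M"
    using Suc P[OF Suc] by (intro measurable_bind_prob_space[where N = M]) auto
  then show ?case
    by (auto dest: measurable_space[where x = "()"])
qed (use \<mu> in simp)

end

section \<open>The distance dual to the dominated functions\<close>

lemma tv_le_of_F:
  assumes \<mu>: "\<mu> \<in> space (prob_algebra M)" and \<nu>: "\<nu> \<in> space (prob_algebra M)"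
    and D: "\<And>f. f \<in> F \<Longrightarrow> (\<integral>x. f x \<partial>\<mu>) - (\<integral>x. f x \<partial>\<nu>) \<le> D"
  shows "tv_norm_diff \<mu> \<nu> \<le> 2 * D"
proof (rule tv_norm_diff_le)
  fix A assume "A \<in> sets \<mu>"
  with \<mu> \<nu> have A: "A \<in> sets M" "A \<in> sets \<mu>" "A \<in> sets \<nu>"
    by (auto simp: space_prob_algebra)
  \<comment> \<open>Differences of indicators are at most 1, hence at most \<open>w\<close>.\<close>
  have "(indicator A :: 'a \<Rightarrow> real) \<in> F"
    unfolding dominated_functions_def
  proof (intro CollectI conjI ballI)
    show "indicator A x - indicator A y \<le> w (x, y)" if "x \<in> space M" "y \<in> space M" for x y
      using w_ge[of "(x, y)"] that by (auto simp: indicator_def space_pair_measure)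
  qed (use A in simp)
  from D[OF this] show "measure \<mu> A - measure \<nu> A \<le> D"
    using A by simp
qed

text \<open>The difference of the new laws splits into \<open>\<mu> - \<nu>\<close> moved by the
  common kernel \<open>P \<mu>\<close>, plus \<open>\<nu>\<close> moved by the difference of
  \<open>P \<mu>\<close> and \<open>P \<nu>\<close>. The first part contracts by
  \<open>P_contraction\<close>, the second is controlled by the Lipschitz condition in total
  variation.\<close>

lemma step_contraction:
  assumes \<mu>: "\<mu> \<in> space (prob_algebra M)" and \<nu>: "\<nu> \<in> space (prob_algebra M)"
    and D: "\<And>f. f \<in> F \<Longrightarrow> (\<integral>x. f x \<partial>\<mu>) - (\<integral>x. f x \<partial>\<nu>) \<le> D"
    and f: "f \<in> F"
  shows "(\<integral>x. f x \<partial>(\<mu> \<bind> P \<mu>)) - (\<integral>x. f x \<partial>(\<nu> \<bind> P \<nu>)) \<le> (\<theta> + K * \<gamma> + K * \<beta>) * D"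
proof -
  let ?Pm = "\<lambda>x. \<integral>u. f u \<partial>P \<mu> x" and ?Pn = "\<lambda>x. \<integral>u. f u \<partial>P \<nu> x"
  define \<eta> where "\<eta> = \<theta> + K * \<gamma>"
  have \<eta>: "0 < \<eta>" using const by (simp add: \<eta>_def add_nonneg_pos)
  have sets: "sets \<nu> = sets M" and space: "space \<nu> = space M" and "prob_space \<nu>"
    using \<nu> by (auto simp: space_prob_algebra dest: sets_eq_imp_space_eq)
  interpret \<nu>: prob_space \<nu> by fact
  \<comment> \<open>Rescaling by the contraction factor returns to \<open>F\<close>, so the
    hypothesis on \<open>D\<close> applies again; the division needs \<open>\<eta>\<close>
    positive.\<close>
  have "(\<lambda>x. ?Pm x / \<eta>) \<in> F"
    using P_contraction[OF \<mu> f] bdd_measurable_measurable[OF P_measurable[OF \<mu> F_bdd[OF f]]] \<eta>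
    by (auto simp: dominated_functions_def diff_divide_distrib[symmetric] divide_le_eq \<eta>_def mult.commute)
  from D[OF this] have 1: "(\<integral>x. ?Pm x \<partial>\<mu>) - (\<integral>x. ?Pm x \<partial>\<nu>) \<le> \<eta> * D"
    using \<eta> by (simp add: diff_divide_distrib[symmetric] divide_le_eq mult.commute)
  have int: "integrable \<nu> ?Pm" "integrable \<nu> ?Pn"
    using P_measurable[OF \<mu> F_bdd[OF f]] P_measurable[OF \<nu> F_bdd[OF f]]
    by (auto intro!: \<nu>.integrable_bdd simp: bdd_measurable_cong_sets[OF sets])
  have "?Pm x - ?Pn x \<le> K * (\<beta> * D)" if x: "x \<in> space M" for x
  proof -
    interpret Q: prob_space "Q x" by (rule Q_prob[OF x])
    \<comment> \<open>\<open>Q x\<close> serves as common dominating measure for the two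
      kernels.\<close>
    have ac: "absolutely_continuous (Q x) (P \<mu> x)" "absolutely_continuous (Q x) (P \<nu> x)"
      using close x \<mu> \<nu> by (auto simp: close_kernels_def)
    have "?Pm x - ?Pn x \<le> K * (tv_norm_diff (P \<mu> x) (P \<nu> x) / 2)"
    proof (rule integral_diff_le_tv[where \<Lambda> = "Q x"])
      show "sigma_finite_measure (Q x)" by unfold_locales
      show "f \<in> borel_measurable (Q x)"
        using bdd_measurable_measurable[OF F_bdd[OF f]] measurable_cong_sets[OF Q_prob(2)[OF x] refl] by blast
      show "f u - f v \<le> K" if "u \<in> space (Q x)" "v \<in> space (Q x)" for u v
        using that F_oscillation[OF f] sets_eq_imp_space_eq[OF Q_prob(2)[OF x]] by simp
    qed (use P_prob[OF \<mu> x] P_prob[OF \<nu> x] Q_prob[OF x] ac const in auto)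
    also have "\<dots> \<le> K * (\<beta> * D)"
    proof (rule mult_left_mono)
      \<comment> \<open>The one-step kernel starts from a point mass at \<open>x\<close>, which is a
        left unit for \<open>\<bind>\<close>.\<close>
      have step: "step_kernel M P \<rho> 1 x = P \<rho> x" if "\<rho> \<in> space (prob_algebra M)" for \<rho>
        using bind_return[OF measurable_prob_algebraD[OF P[OF that]] x] by simp
      have "tv_norm_diff (P \<mu> x) (P \<nu> x) \<le> \<beta> * tv_norm_diff \<mu> \<nu>"
        using lip[unfolded tv_lipschitz_def, rule_format, OF x \<mu> \<nu>] by (simp only: step[OF \<mu>] step[OF \<nu>])
      also have "\<dots> \<le> \<beta> * (2 * D)"
        using tv_le_of_F[OF \<mu> \<nu> D] const by (intro mult_left_mono)
      finally show "tv_norm_diff (P \<mu> x) (P \<nu> x) / 2 \<le> \<beta> * D" by simp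
    qed (use const in simp)
    finally show ?thesis .
  qed
  then have "(\<integral>x. ?Pm x - ?Pn x \<partial>\<nu>) \<le> (\<integral>x. K * (\<beta> * D) \<partial>\<nu>)"
    using int space by (intro integral_mono) auto
  then have 2: "(\<integral>x. ?Pm x \<partial>\<nu>) - (\<integral>x. ?Pn x \<partial>\<nu>) \<le> K * (\<beta> * D)"
    using int by (simp add: \<nu>.prob_space)
  show ?thesis
    using 1 2 integral_law_step[OF \<mu> \<mu> F_bdd[OF f]] integral_law_step[OF \<nu> \<nu> F_bdd[OF f]]
    by (simp add: \<eta>_def algebra_simps)
qed

text \<open>The one-step contraction is iterated, starting from the oscillation bound
  \<open>K\<close>.\<close>

lemma law_contraction:
  assumes \<mu>: "\<mu> \<in> space (prob_algebra M)" and \<nu>: "\<nu> \<in> space (prob_algebra M)" and f: "f \<in> F"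
  shows "(\<integral>x. f x \<partial>law P \<mu> n) - (\<integral>x. f x \<partial>law P \<nu> n) \<le> (\<theta> + K * \<gamma> + K * \<beta>) ^ n * K"
  using f
proof (induction n arbitrary: f)
  case 0
  have prob: "prob_space \<mu>" "prob_space \<nu>" and sets: "sets \<mu> = sets M" "sets \<nu> = sets M"
    and space: "space \<mu> = space M" "space \<nu> = space M"
    using \<mu> \<nu> by (auto simp: space_prob_algebra dest: sets_eq_imp_space_eq)
  interpret \<mu>: prob_space \<mu> by fact
  interpret \<nu>: prob_space \<nu> by fact
  obtain c where c: "\<And>u. u \<in> space M \<Longrightarrow> c \<le> f u" "\<And>u. u \<in> space M \<Longrightarrow> f u \<le> c + K"
    using oscillation_bounds[of "space M" f K] F_oscillation[OF 0] \<mu>.not_empty space by metis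
  have int: "integrable \<mu> f" "integrable \<nu> f"
    using F_bdd[OF 0] by (auto intro!: \<mu>.integrable_bdd \<nu>.integrable_bdd
        simp: bdd_measurable_cong_sets[OF sets(1)] bdd_measurable_cong_sets[OF sets(2)])
  have "(\<integral>x. f x \<partial>\<mu>) \<le> c + K"
    by (rule \<mu>.integral_le_const[OF int(1) AE_I2]) (use c space in simp)
  moreover have "c \<le> (\<integral>x. f x \<partial>\<nu>)"
    by (rule \<nu>.integral_ge_const[OF int(2) AE_I2]) (use c space in simp)
  ultimately show ?case by simp
next
  case (Suc n)
  show ?case
    using step_contraction[OF law_mem[OF \<mu>] law_mem[OF \<nu>] Suc.IH Suc.prems] by (simp add: mult.assoc)
qed

lemma tv_law_le:
  assumes "\<mu> \<in> space (prob_algebra M)" "\<nu> \<in> space (prob_algebra M)"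
  shows "tv_norm_diff (law P \<mu> n) (law P \<nu> n) \<le> 2 * K * (\<theta> + K * \<gamma> + K * \<beta>) ^ n"
  using tv_le_of_F[OF law_mem[OF assms(1)] law_mem[OF assms(2)] law_contraction[OF assms]]
  by (simp add: mult_ac)

end

theorem theorem1:
  fixes M :: "'a measure"
    and Q :: "'a \<Rightarrow> 'a measure"
    and L :: "'a \<Rightarrow> 'a \<Rightarrow> 'a measure"
  assumes "Q \<in> M \<rightarrow>\<^sub>M prob_algebra M"
    and "dominating M Q L"
    and "\<And>h. h \<in> bdd_measurable (M \<Otimes>\<^sub>M M) \<Longrightarrow> V_op L Q h \<in> borel_measurable (M \<Otimes>\<^sub>M M)"
  shows "\<exists>\<delta>0>0. \<forall>\<delta>. 0 < \<delta> \<and> \<delta> < \<delta>0 \<longrightarrow>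
    (\<exists>lamd gamd C. 0 < lamd \<and> 0 < gamd \<and> 0 < C \<and>
      (\<forall>\<gamma> lam1. 0 < \<gamma> \<and> \<gamma> < gamd \<and> 0 \<le> lam1 \<and> lam1 < lamd \<longrightarrow>
        (\<forall>P :: 'a measure \<Rightarrow> 'a \<Rightarrow> 'a measure.
          (\<forall>\<mu>\<in>space (prob_algebra M). P \<mu> \<in> M \<rightarrow>\<^sub>M prob_algebra M) \<and>
          close_kernels M Q P \<gamma> \<and>
          (\<exists>lam :: nat \<Rightarrow> real. lam 1 = lam1 \<and> (\<forall>k\<ge>1. tv_lipschitz M P k (lam k))) \<longrightarrow>
          (\<forall>\<^sub>F n in sequentially.
            \<forall>\<mu>\<in>space (prob_algebra M). \<forall>\<nu>\<in>space (prob_algebra M).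
              tv_norm_diff (law P \<mu> n) (law P \<nu> n)
                \<le> 2 * C * (op_spectral_radius (M \<Otimes>\<^sub>M M) (V_op L Q) + \<delta>) ^ n))))"
    (is "\<exists>\<delta>0>0. \<forall>\<delta>. 0 < \<delta> \<and> \<delta> < \<delta>0 \<longrightarrow> ?claim \<delta>")
proof -
  interpret dominated_kernel M Q L by unfold_locales fact+
  have "?claim \<delta>" if \<delta>: "0 < \<delta>" for \<delta>
  proof (cases "space M = {}")
    \<comment> \<open>An empty space carries no probability measure, so any positive constants will
      do.\<close>
    case True
    have "\<mu> \<notin> space (prob_algebra M)" for \<mu>
      using prob_space.not_empty[of \<mu>] sets_eq_imp_space_eq[of \<mu> M] True
      by (auto simp: space_prob_algebra)
    then have "space (prob_algebra M) = {}"
      by blast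
    then show ?thesis
      by (intro exI[of _ "1::real"]) simp
  next
    case False
    let ?N = "M \<Otimes>\<^sub>M M"
    let ?s = "op_spectral_radius ?N (V_op L Q) + \<delta>"
    interpret V: positive_operator ?N "V_op L Q"
      by (rule positive_operator_V_op[OF False assms(3)])
    obtain w \<theta> K where w: "w \<in> bdd_measurable ?N" "0 \<le> \<theta>" "\<theta> < ?s"
      "\<forall>p\<in>space ?N. 1 \<le> w p \<and> w p \<le> K \<and> V_op L Q w p \<le> \<theta> * w p"
      using V.Lyapunov_function_exists[OF less_add_same_cancel1[THEN iffD2, OF \<delta>]] .
    have K: "1 \<le> K"
    proof -
      obtain p where "p \<in> space ?N" using V.ne by blast
      with w(4) show ?thesis by force
    qed
    \<comment> \<open>Each of the two errors \<open>K * \<gamma>\<close> and \<open>K * lam1\<close>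
      may use up half of the gap between \<open>\<theta>\<close> and \<open>?s\<close>.\<close>
    let ?e = "(?s - \<theta>) / (2 * K)"
    have e: "0 < ?e" using w(3) K by simp
    have main: "tv_norm_diff (law P \<mu> n) (law P \<nu> n) \<le> 2 * K * ?s ^ n"
      if \<gamma>: "0 < \<gamma>" "\<gamma> < ?e" and lam: "0 \<le> lam1" "lam1 < ?e"
        and P: "\<forall>\<mu>\<in>space (prob_algebra M). P \<mu> \<in> M \<rightarrow>\<^sub>M prob_algebra M"
          "close_kernels M Q P \<gamma>" "tv_lipschitz M P 1 lam1"
        and \<mu>: "\<mu> \<in> space (prob_algebra M)" and \<nu>: "\<nu> \<in> space (prob_algebra M)"
      for \<gamma> lam1 P \<mu> \<nu> n
    proof -
      interpret chain: perturbed_chain M Q L w \<theta> K \<gamma> lam1 P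
        using w K \<gamma>(1) lam(1) P by unfold_locales blast+
      have "K * \<gamma> \<le> (?s - \<theta>) / 2" "K * lam1 \<le> (?s - \<theta>) / 2"
        using \<gamma>(2) lam(2) K by (simp_all add: field_simps)
      then have "\<theta> + K * \<gamma> + K * lam1 \<le> ?s"
        by (simp add: field_simps)
      then have "(\<theta> + K * \<gamma> + K * lam1) ^ n \<le> ?s ^ n"
        using w(2) K \<gamma> lam by (intro power_mono) auto
      then have "2 * K * (\<theta> + K * \<gamma> + K * lam1) ^ n \<le> 2 * K * ?s ^ n"
        using K by (intro mult_left_mono) auto
      then show ?thesis by (rule order_trans[OF chain.tv_law_le[OF \<mu> \<nu>]])
    qed
    show ?thesis
    \<comment> \<open>The upper bound \<open>K\<close> of the Lyapunov function becomes the constant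
      \<open>C\<close>, and the estimate holds for every \<open>n\<close>.\<close>
    proof (rule exI[of _ ?e], rule exI[of _ ?e], rule exI[of _ K],
        intro conjI allI impI always_eventually ballI)
      fix \<gamma> lam1 n \<mu> \<nu> and P :: "'a measure \<Rightarrow> 'a \<Rightarrow> 'a measure"
      assume c: "0 < \<gamma> \<and> \<gamma> < ?e \<and> 0 \<le> lam1 \<and> lam1 < ?e"
        and P: "(\<forall>\<mu>\<in>space (prob_algebra M). P \<mu> \<in> M \<rightarrow>\<^sub>M prob_algebra M) \<and> close_kernels M Q P \<gamma> \<and>
          (\<exists>lam :: nat \<Rightarrow> real. lam 1 = lam1 \<and> (\<forall>k\<ge>1. tv_lipschitz M P k (lam k)))"
        and \<mu>: "\<mu> \<in> space (prob_algebra M)" and \<nu>: "\<nu> \<in> space (prob_algebra M)"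
      have "tv_lipschitz M P 1 lam1" using P by force
      then show "tv_norm_diff (law P \<mu> n) (law P \<nu> n) \<le> 2 * K * ?s ^ n"
        using main c P \<mu> \<nu> by blast
    qed (use e K in simp_all)
  qed
  then show ?thesis by (intro exI[of _ 1]) auto
qed

end
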